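(* Let $G$ be a compact (Hausdorff) group and let $\mathfrak K=(\mathfrak E,\mathrm R,D)$ be an L-coherent coabelian classification datum for $G$. Let $C^{\mathfrak E}/\Phi$ be a representation of $\mathfrak E$ and let $\theta:\mathrm{Hom}(D^{\mathfrak E},\Pi_{\mathfrak K})\to C^{\mathfrak E}/\Phi$ be an isomorphism in $\mathsf{Fct}(\mathfrak E,\mathsf{TAb})$. For $(H,U)\in\mathfrak E_{\mathrm b}$ the following holds: (i) $\Phi(H,U)$ is closed in $C(H)$. (ii) If $U$ is open in $H$ and either $D=\mathbb Z$ (the constant functor with value the discrete group $\mathbb Z$) or all values of $D$ are compact, then $\Phi(H,U)$ is open in $C(H)$. (iii) If $U\,\mathrm R(H)\in\mathrm{Ext}(\mathfrak E,H)$, then $\Phi(H,U\,\mathrm R(H))=\Phi(H,U)$. (iv) If $g\in G$, then $\mathrm{con}^C_{g,H}(\Phi(H,U))=\Phi({}^gH,{}^gU)$. (v) The map $\Phi(H,-)$ from $\mathrm{Ext}(\mathfrak E,H)$ to the set $\mathcal E^{\mathrm t}(C(H))$ of closed subgroups of $C(H)$ is monotone with respect to inclusion. (vi) Let $U_1,U_2\in\mathrm{Ext}(\mathfrak E,H)$ with $U_2\le U_1$. Identify $\mathrm{Hom}_{\mathsf{TAb}}(D(H),U_1\mathrm R(H)/U_2\mathrm R(H))$ with a subgroup of $\mathrm{Hom}_{\mathsf{TAb}}(D(H),H/U_2\mathrm R(H))=\mathrm{Hom}(D^{\mathfrak E},\Pi_{\mathfrak K})(H,U_2)$ via composition with the inclusion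 $U_1\mathrm R(H)/U_2\mathrm R(H)\to H/U_2\mathrm R(H)$. Then $$\theta_{(H,U_2)}\big(\mathrm{Hom}_{\mathsf{TAb}}(D(H),U_1\mathrm R(H)/U_2\mathrm R(H))\big)=\Phi(H,U_1)/\Phi(H,U_2)\le C(H)/\Phi(H,U_2).$$ (vii) If $U_1,U_2\in\mathrm{Ext}_{\mathrm R}(\mathfrak E,H)$ with $U_1U_2\in\mathrm{Ext}(\mathfrak E,H)$ and $U_1\cap U_2\in\mathrm{Ext}(\mathfrak E,H)$, then $\Phi(H,U_1U_2)=\Phi(H,U_1)\cdot\Phi(H,U_2)$. (viii) If $U_1,U_2\in\mathrm{Ext}_{\mathrm R}(\mathfrak E,H)$ with $U_1\cap U_2\in\mathrm{Ext}(\mathfrak E,H)$, then $\Phi(H,U_1\cap U_2)=\Phi(H,U_1)\cap\Phi(H,U_2)$. (ix) If $\mathcal L$ is an $\mathrm R$-lattice in $\mathfrak E$, then $\Phi(H,-)|_{\mathcal L(H)}:\mathcal L(H)\to\mathcal E^{\mathrm t}(C(H))$ is injective.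
   Context: $\mathsf{TAb}$ is the category of topological abelian groups (not necessarily Hausdorff); compact and locally compact include Hausdorff. ${}^gH=gHg^{-1}$. RIC-functors. A RIC-domain $\mathfrak D$ consists of a non-empty set $\mathfrak D_{\mathrm b}$ with a left action $(g,x)\mapsto{}^gx$ of a group $G$ and, for each $x\in\mathfrak D_{\mathrm b}$, subsets $\mathfrak D_{\mathrm r}(x),\mathfrak D_{\mathrm i}(x)\subseteq\mathfrak D_{\mathrm b}$ such that for $\star\in\{\mathrm r,\mathrm i\}$: $x\in\mathfrak D_\star(x)$; $y\in\mathfrak D_\star(x)$ implies $\mathfrak D_\star(y)\subseteq\mathfrak D_\star(x)$; ${}^g\mathfrak D_\star(x)=\mathfrak D_\star({}^gx)$. A RIC-functor $\Phi:\mathfrak D\to\mathcal C$ into a category $\mathcal C$ consists of objects $\Phi(x)$ and morphisms $\mathrm{res}_{y,x}:\Phi(x)\to\Phi(y)$ ($y\in\mathfrak D_{\mathrm r}(x)$), $\mathrm{ind}_{x,y}:\Phi(y)\to\Phi(x)$ ($y\in\mathfrak D_{\mathrm i}(x)$), $\mathrm{con}_{g,x}:\Phi(x)\to\Phi({}^gx)$ ($g\in G$) such that $\mathrm{res}_{x,x}=\mathrm{ind}_{x,x}=\mathrm{con}_{1,x}=\mathrm{id}$; $\mathrm{res}_{z,y}\mathrm{res}_{y,x}=\mathrm{res}_{z,x}$, $\mathrm{ind}_{x,y}\mathrm{ind}_{y,z}=\mathrm{ind}_{x,z}$, $\mathrm{con}_{g',{}^gx}\mathrm{con}_{g,x}=\mathrm{con}_{g'g,x}$;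 $\mathrm{con}_{g,y}\mathrm{res}_{y,x}=\mathrm{res}_{{}^gy,{}^gx}\mathrm{con}_{g,x}$ and $\mathrm{con}_{g,x}\mathrm{ind}_{x,y}=\mathrm{ind}_{{}^gx,{}^gy}\mathrm{con}_{g,y}$. Morphisms are families $(\varphi_x)$ of morphisms commuting with res, ind, con; the category is $\mathsf{Fct}(\mathfrak D,\mathcal C)$. For $\Phi\in\mathsf{Fct}(\mathfrak D,\mathsf{TAb})$ a subfunctor is a family of subgroups $\Phi'(x)\le\Phi(x)$ stable under res, ind, con; the quotient functor $\Phi/\Phi'$ has values $\Phi(x)/\Phi'(x)$ (quotient topology) and induced morphisms. $G$-spectra. A $G$-subgroup system is a RIC-domain $\mathfrak S$ where $\mathfrak S_{\mathrm b}$ is a set of subgroups of $G$ with the conjugation action and $I\le H$ for $I\in\mathfrak S_\star(H)$. Let $\mathrm{Grp}^2(G)$ be the set of pairs $(H,U)$ with $H$ a closed subgroup of $G$ and $U$ a closed normal subgroup of $H$, ordered componentwise by inclusion, with componentwise conjugation. A two-dimensional $G$-subgroup system is a RIC-domain $\mathfrak E$ with $\mathfrak E_{\mathrm b}\subseteq\mathrm{Grp}^2(G)$ (conjugation action) and $(I,V)\le(H,U)$ for $(I,V)\in\mathfrak E_\star(H,U)$. Put $\mathfrak E^\flat_{\mathrm b}=\{H:(H,U)\in\mathfrak E_{\mathrm b}\text{ for some }U\}$, $\mathrm{Ext}(\mathfrak E,H)=\{U:(H,U)\in\mathfrak E_{\mathrm b}\}$, and let $\mathfrak E^\flat_\star(H)$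 be the set of first components of elements of $\bigcup_{U}\mathfrak E_\star(H,U)$. $\mathfrak E$ is regular if $\mathfrak E^\flat=(\mathfrak E^\flat_{\mathrm b},\mathfrak E^\flat_{\mathrm r},\mathfrak E^\flat_{\mathrm i})$ is a $G$-subgroup system. A $G$-spectrum is a regular $\mathfrak E$ such that $(I,V)\in\mathfrak E_{\mathrm r}(H,U)$ implies $V=U$, and $[H:I]<\infty$ whenever $I\in\mathfrak E^\flat_{\mathrm r}(H)$. For $C\in\mathsf{Fct}(\mathfrak E^\flat,\mathcal C)$ let $C^{\mathfrak E}\in\mathsf{Fct}(\mathfrak E,\mathcal C)$ be $C^{\mathfrak E}(H,U)=C(H)$ with the res, ind, con of $C$ on first components. A representation of $\mathfrak E$ is a quotient $C^{\mathfrak E}/\Phi$ with $C\in\mathsf{Fct}(\mathfrak E^\flat,\mathsf{TAb})$ and $\Phi$ a subfunctor of $C^{\mathfrak E}$; the groups $C(H)$ are written multiplicatively. Transfer. For $I\le H$ closed of finite index with right transversal $T=(t_1,\dots,t_n)$ write $t_ih=\kappa_T(t_ih)t_{\sigma(i)}$ with $\kappa_T(t_ih)\in I$, $\sigma$ a permutation. For $N\lhd I$ with $I/N$ abelian, $\mathrm V^{N}_{I,H}:H\to I/N$, $h\mapsto\prod_i\kappa_T(t_ih)\bmod N$, is a continuous homomorphism independent of $T$. Coabelian classification data. An abelianization system on a $G$-subgroup system $\mathfrak S$ consisting of closed subgroups with $[H:I]<\infty$ for $I\in\mathfrak S_{\mathrm r}(H)$ is a family $\mathrm R(H)\lhd H$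 ($H\in\mathfrak S_{\mathrm b}$) of closed normal subgroups with $H/\mathrm R(H)$ abelian, such that $\mathrm R({}^gH)={}^g\mathrm R(H)$, $\mathrm R(H)\subseteq\ker\mathrm V^{\mathrm R(I)}_{I,H}$ for $I\in\mathfrak S_{\mathrm r}(H)$, and $\mathrm R(I)\subseteq\mathrm R(H)$ for $I\in\mathfrak S_{\mathrm i}(H)$. A dualizing functor $D$ on $\mathfrak E^\flat$ is a RIC-functor with values locally compact abelian groups whose res and ind are all isomorphisms. A coabelian classification datum is a triple $\mathfrak K=(\mathfrak E,\mathrm R,D)$: $\mathfrak E$ a $G$-spectrum, $\mathrm R$ an abelianization system on $\mathfrak E^\flat$, $D$ a dualizing functor on $\mathfrak E^\flat$. $\Pi_{\mathfrak K}\in\mathsf{Fct}(\mathfrak E,\mathsf{TAb})$ is given by $\Pi_{\mathfrak K}(H,U)=H/U\mathrm R(H)$, with con induced by conjugation, $\mathrm{ind}_{(H,U),(I,V)}$ induced by the inclusion $I\to H$, and $\mathrm{res}_{(I,U),(H,U)}$ induced by $\mathrm V^{U\mathrm R(I)}_{I,H}$. $\mathrm{Hom}(D^{\mathfrak E},\Pi_{\mathfrak K})\in\mathsf{Fct}(\mathfrak E,\mathsf{TAb})$ has values $\mathrm{Hom}_{\mathsf{TAb}}(D(H),\Pi_{\mathfrak K}(H,U))$ (compact-open topology) and each structure map $\mathrm{res}$ (resp. ind, con) is $\chi\mapsto\mathrm{res}^{\Pi_{\mathfrak K}}\circ\chi\circ(\mathrm{res}^{D})^{-1}$ (resp. with ind,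 con). $\mathrm{Ext}_{\mathrm R}(\mathfrak E,H)=\{U\in\mathrm{Ext}(\mathfrak E,H):U\ge\mathrm R(H)\}$. An $\mathrm R$-lattice $\mathcal L$ in $\mathfrak E$ is a family $\mathcal L(H)\subseteq\mathrm{Ext}_{\mathrm R}(\mathfrak E,H)$ ($H\in\mathfrak E^\flat_{\mathrm b}$), each $\mathcal L(H)$ being a lattice with respect to products and intersections. $\mathfrak K$ is L-coherent if for all $H\in\mathfrak E^\flat_{\mathrm b}$: (1) if $U_1,U_2\in\mathrm{Ext}_{\mathrm R}(\mathfrak E,H)$ with $U_2\le U_1$, then $(H,U_2)\in\mathfrak E_{\mathrm i}(H,U_1)$; (2) if $U_1,U_2\in\mathrm{Ext}_{\mathrm R}(\mathfrak E,H)$ with $U_2\le U_1$ and $\mathrm{Hom}_{\mathsf{TAb}}(D(H),U_1/U_2)$ is trivial, then $U_1=U_2$.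
   Formalization: As L-coherence gives inductions only within Ext_R, (iii), (v), (vi) are false as stated; (iii) additionally assumes (H,U) ∈ E_i(H,U R(H)), and the monotonicity in (v) and (vi) additionally assume (H,U2) ∈ E_i(H,U1). *)

theory Defs
  imports "HOL-Analysis.Analysis" "HOL-Algebra.Group_Action" "HOL-Algebra.Elementary_Groups"
begin

record 'a tgroup = "'a monoid" +
  topol :: "'a topology"

locale topological_group = group G for G :: "'a tgroup" (structure) +
  assumes topspace_topol: "topspace (topol G) = carrier G"
    and continuous_mult:
      "continuous_map (prod_topology (topol G) (topol G)) (topol G) (\<lambda>(x, y). x \<otimes> y)"
    and continuous_inv: "continuous_map (topol G) (topol G) (\<lambda>x. inv x)"

definition topological_abelian_group :: "'a tgroup \<Rightarrow> bool" where
  "topological_abelian_group A \<longleftrightarrow> topological_group A \<and> comm_group A"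

definition locally_compact_abelian_group :: "'a tgroup \<Rightarrow> bool" where
  "locally_compact_abelian_group A \<longleftrightarrow> topological_abelian_group A \<and>
     locally_compact_space (topol A) \<and> Hausdorff_space (topol A)"

definition tg_hom :: "'a tgroup \<Rightarrow> 'b tgroup \<Rightarrow> ('a \<Rightarrow> 'b) set" where
  "tg_hom A B = {f \<in> hom A B. continuous_map (topol A) (topol B) f}"

definition tg_iso :: "'a tgroup \<Rightarrow> 'b tgroup \<Rightarrow> ('a \<Rightarrow> 'b) set" where
  "tg_iso A B = {f \<in> iso A B. homeomorphic_map (topol A) (topol B) f}"

definition closed_subgroup :: "'a set \<Rightarrow> 'a tgroup \<Rightarrow> bool" where
  "closed_subgroup H G \<longleftrightarrow> subgroup H G \<and> closedin (topol G) H"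

definition tg_sub :: "'a tgroup \<Rightarrow> 'a set \<Rightarrow> 'a tgroup" where
  "tg_sub G H = G\<lparr>carrier := H, topol := subtopology (topol G) H\<rparr>"

definition quot_topology :: "'a tgroup \<Rightarrow> 'a set \<Rightarrow> 'a set topology" where
  "quot_topology G N = topology (\<lambda>S. S \<subseteq> rcosets\<^bsub>G\<^esub> N \<and>
     openin (topol G) {x \<in> carrier G. N #>\<^bsub>G\<^esub> x \<in> S})"

text \<open>For \<open>N \<subseteq> H\<close> the cosets of \<open>N\<close> in \<open>H\<close> are elements of \<open>G / N\<close>, so the inclusion of \<open>H / N\<close> into
  \<open>G / N\<close> is the identity on elements.\<close>

definition tg_quot :: "'a tgroup \<Rightarrow> 'a set \<Rightarrow> 'a set tgroup" where
  "tg_quot G N = \<lparr>carrier = carrier (G Mod N), mult = mult (G Mod N), one = one (G Mod N),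
     topol = quot_topology G N\<rparr>"

lemma openin_quot_topology:
  assumes "topspace (topol G) = carrier G"
  shows "openin (quot_topology G N) S \<longleftrightarrow>
    S \<subseteq> rcosets\<^bsub>G\<^esub> N \<and> openin (topol G) {x \<in> carrier G. N #>\<^bsub>G\<^esub> x \<in> S}"
proof -
  let ?P = "\<lambda>S. S \<subseteq> rcosets\<^bsub>G\<^esub> N \<and> openin (topol G) {x \<in> carrier G. N #>\<^bsub>G\<^esub> x \<in> S}"
  have "istopology ?P"
    unfolding istopology_def
  proof (intro conjI allI impI)
    fix S T assume S: "?P S" and T: "?P T"
    then show "S \<inter> T \<subseteq> rcosets\<^bsub>G\<^esub> N" by blast
    have "{x \<in> carrier G. N #>\<^bsub>G\<^esub> x \<in> S \<inter> T} =
        {x \<in> carrier G. N #>\<^bsub>G\<^esub> x \<in> S} \<inter> {x \<in> carrier G. N #>\<^bsub>G\<^esub> x \<in> T}"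
      by blast
    then show "openin (topol G) {x \<in> carrier G. N #>\<^bsub>G\<^esub> x \<in> S \<inter> T}"
      using S T by auto
  next
    fix K assume K: "\<forall>S\<in>K. ?P S"
    then show "\<Union>K \<subseteq> rcosets\<^bsub>G\<^esub> N" by blast
    have "{x \<in> carrier G. N #>\<^bsub>G\<^esub> x \<in> \<Union>K} = (\<Union>S\<in>K. {x \<in> carrier G. N #>\<^bsub>G\<^esub> x \<in> S})"
      by blast
    then show "openin (topol G) {x \<in> carrier G. N #>\<^bsub>G\<^esub> x \<in> \<Union>K}"
      using K by auto
  qed
  then show ?thesis
    by (simp add: quot_topology_def)
qed

text \<open>The map on a quotient group \<open>A / N\<close> induced by a map \<open>f\<close> on \<open>A\<close> that is constant on
  the cosets of \<open>N\<close>.\<close>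

definition quot_induced :: "('a \<Rightarrow> 'b) \<Rightarrow> 'a set \<Rightarrow> 'b" where
  "quot_induced f X = the_elem (f ` X)"

text \<open>Continuous homomorphisms with the compact-open topology. Elements are extensional functions,
  so that each homomorphism is represented exactly once.\<close>

definition tg_Hom_set :: "'a tgroup \<Rightarrow> 'b tgroup \<Rightarrow> ('a \<Rightarrow> 'b) set" where
  "tg_Hom_set A B = tg_hom A B \<inter> extensional (carrier A)"

definition tg_Hom :: "'a tgroup \<Rightarrow> 'b tgroup \<Rightarrow> ('a \<Rightarrow> 'b) tgroup" where
  "tg_Hom A B = \<lparr>carrier = tg_Hom_set A B,
     mult = (\<lambda>f g. \<lambda>a\<in>carrier A. f a \<otimes>\<^bsub>B\<^esub> g a),
     one = (\<lambda>a\<in>carrier A. \<one>\<^bsub>B\<^esub>),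
     topol = topology_generated_by
       {{f \<in> tg_Hom_set A B. f ` K \<subseteq> V} |K V. compactin (topol A) K \<and> openin (topol B) V}\<rparr>"

record ('g, 'x) ric_domain =
  Base :: "'x set"
  Act :: "'g \<Rightarrow> 'x \<Rightarrow> 'x"
  DRes :: "'x \<Rightarrow> 'x set"
  DInd :: "'x \<Rightarrow> 'x set"

definition ric_family ::
    "'g tgroup \<Rightarrow> ('g, 'x) ric_domain \<Rightarrow> ('x \<Rightarrow> 'x set) \<Rightarrow> bool" where
  "ric_family G D S \<longleftrightarrow> (\<forall>x\<in>Base D.
     S x \<subseteq> Base D \<and> x \<in> S x \<and> (\<forall>y\<in>S x. S y \<subseteq> S x) \<and>
     (\<forall>g\<in>carrier G. Act D g ` S x = S (Act D g x)))"

text \<open>The action is restricted to the base set because \<open>group_action\<close> requires extensional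
  permutations.\<close>

definition ric_domain :: "'g tgroup \<Rightarrow> ('g, 'x) ric_domain \<Rightarrow> bool" where
  "ric_domain G D \<longleftrightarrow> Base D \<noteq> {} \<and>
     group_action G (Base D) (\<lambda>g. restrict (Act D g) (Base D)) \<and>
     ric_family G D (DRes D) \<and> ric_family G D (DInd D)"

text \<open>In \<open>Res F y x : Obj F x \<rightarrow> Obj F y\<close> and \<open>Ind F x y : Obj F y \<rightarrow> Obj F x\<close> the target comes
  first. Since HOL functions are total, morphisms are compared on carriers only. All values of a
  functor live on one type, which can be taken to be a disjoint union.\<close>

record ('g, 'x, 'a) ric_functor =
  Obj :: "'x \<Rightarrow> 'a tgroup"
  Res :: "'x \<Rightarrow> 'x \<Rightarrow> 'a \<Rightarrow> 'a"
  Ind :: "'x \<Rightarrow> 'x \<Rightarrow> 'a \<Rightarrow> 'a"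
  Con :: "'g \<Rightarrow> 'x \<Rightarrow> 'a \<Rightarrow> 'a"

locale ric_functor =
  fixes G :: "'g tgroup" and D :: "('g, 'x) ric_domain" and F :: "('g, 'x, 'a) ric_functor"
  assumes obj: "x \<in> Base D \<Longrightarrow> topological_abelian_group (Obj F x)"
    and res_hom: "\<lbrakk>x \<in> Base D; y \<in> DRes D x\<rbrakk> \<Longrightarrow> Res F y x \<in> tg_hom (Obj F x) (Obj F y)"
    and ind_hom: "\<lbrakk>x \<in> Base D; y \<in> DInd D x\<rbrakk> \<Longrightarrow> Ind F x y \<in> tg_hom (Obj F y) (Obj F x)"
    and con_hom: "\<lbrakk>x \<in> Base D; g \<in> carrier G\<rbrakk> \<Longrightarrow> Con F g x \<in> tg_hom (Obj F x) (Obj F (Act D g x))"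
    and res_id: "\<lbrakk>x \<in> Base D; a \<in> carrier (Obj F x)\<rbrakk> \<Longrightarrow> Res F x x a = a"
    and ind_id: "\<lbrakk>x \<in> Base D; a \<in> carrier (Obj F x)\<rbrakk> \<Longrightarrow> Ind F x x a = a"
    and con_id: "\<lbrakk>x \<in> Base D; a \<in> carrier (Obj F x)\<rbrakk> \<Longrightarrow> Con F \<one>\<^bsub>G\<^esub> x a = a"
    and res_comp: "\<lbrakk>x \<in> Base D; y \<in> DRes D x; z \<in> DRes D y; a \<in> carrier (Obj F x)\<rbrakk>
      \<Longrightarrow> Res F z y (Res F y x a) = Res F z x a"
    and ind_comp: "\<lbrakk>x \<in> Base D; y \<in> DInd D x; z \<in> DInd D y; a \<in> carrier (Obj F z)\<rbrakk>
      \<Longrightarrow> Ind F x y (Ind F y z a) = Ind F x z a"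
    and con_comp: "\<lbrakk>x \<in> Base D; g \<in> carrier G; g' \<in> carrier G; a \<in> carrier (Obj F x)\<rbrakk>
      \<Longrightarrow> Con F g' (Act D g x) (Con F g x a) = Con F (g' \<otimes>\<^bsub>G\<^esub> g) x a"
    and con_res: "\<lbrakk>x \<in> Base D; y \<in> DRes D x; g \<in> carrier G; a \<in> carrier (Obj F x)\<rbrakk>
      \<Longrightarrow> Con F g y (Res F y x a) = Res F (Act D g y) (Act D g x) (Con F g x a)"
    and con_ind: "\<lbrakk>x \<in> Base D; y \<in> DInd D x; g \<in> carrier G; a \<in> carrier (Obj F y)\<rbrakk>
      \<Longrightarrow> Con F g x (Ind F x y a) = Ind F (Act D g x) (Act D g y) (Con F g y a)"

locale ric_morphism =
  fixes G :: "'g tgroup" and D :: "('g, 'x) ric_domain"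
    and F :: "('g, 'x, 'a) ric_functor" and F' :: "('g, 'x, 'b) ric_functor"
    and \<phi> :: "'x \<Rightarrow> 'a \<Rightarrow> 'b"
  assumes hom: "x \<in> Base D \<Longrightarrow> \<phi> x \<in> tg_hom (Obj F x) (Obj F' x)"
    and res: "\<lbrakk>x \<in> Base D; y \<in> DRes D x; a \<in> carrier (Obj F x)\<rbrakk>
      \<Longrightarrow> \<phi> y (Res F y x a) = Res F' y x (\<phi> x a)"
    and ind: "\<lbrakk>x \<in> Base D; y \<in> DInd D x; a \<in> carrier (Obj F y)\<rbrakk>
      \<Longrightarrow> \<phi> x (Ind F x y a) = Ind F' x y (\<phi> y a)"
    and con: "\<lbrakk>x \<in> Base D; g \<in> carrier G; a \<in> carrier (Obj F x)\<rbrakk>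
      \<Longrightarrow> \<phi> (Act D g x) (Con F g x a) = Con F' g x (\<phi> x a)"

definition ric_iso ::
    "'g tgroup \<Rightarrow> ('g, 'x) ric_domain \<Rightarrow> ('g, 'x, 'a) ric_functor \<Rightarrow> ('g, 'x, 'b) ric_functor
      \<Rightarrow> ('x \<Rightarrow> 'a \<Rightarrow> 'b) \<Rightarrow> bool" where
  "ric_iso G D F F' \<phi> \<longleftrightarrow> ric_morphism G D F F' \<phi> \<and>
     (\<exists>\<psi>. ric_morphism G D F' F \<psi> \<and>
       (\<forall>x\<in>Base D. (\<forall>a\<in>carrier (Obj F x). \<psi> x (\<phi> x a) = a) \<and>
                   (\<forall>b\<in>carrier (Obj F' x). \<phi> x (\<psi> x b) = b)))"

definition ric_subfunctor ::
    "'g tgroup \<Rightarrow> ('g, 'x) ric_domain \<Rightarrow> ('g, 'x, 'a) ric_functor \<Rightarrow> ('x \<Rightarrow> 'a set) \<Rightarrow> bool" where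
  "ric_subfunctor G D F P \<longleftrightarrow> (\<forall>x\<in>Base D.
     subgroup (P x) (Obj F x) \<and>
     (\<forall>y\<in>DRes D x. Res F y x ` P x \<subseteq> P y) \<and>
     (\<forall>y\<in>DInd D x. Ind F x y ` P y \<subseteq> P x) \<and>
     (\<forall>g\<in>carrier G. Con F g x ` P x \<subseteq> P (Act D g x)))"

definition ric_quotient ::
    "('g, 'x) ric_domain \<Rightarrow> ('g, 'x, 'a) ric_functor \<Rightarrow> ('x \<Rightarrow> 'a set)
      \<Rightarrow> ('g, 'x, 'a set) ric_functor" where
  "ric_quotient D F P = \<lparr>
     Obj = (\<lambda>x. tg_quot (Obj F x) (P x)),
     Res = (\<lambda>y x. quot_induced (\<lambda>a. P y #>\<^bsub>Obj F y\<^esub> Res F y x a)),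
     Ind = (\<lambda>x y. quot_induced (\<lambda>a. P x #>\<^bsub>Obj F x\<^esub> Ind F x y a)),
     Con = (\<lambda>g x. quot_induced (\<lambda>a. P (Act D g x) #>\<^bsub>Obj F (Act D g x)\<^esub> Con F g x a))\<rparr>"

text \<open>The functor \<open>x \<mapsto> Hom (D x) (F x)\<close> for \<open>D\<close> with invertible structure maps.\<close>

definition ric_Hom ::
    "('g, 'x) ric_domain \<Rightarrow> ('g, 'x, 'd) ric_functor \<Rightarrow> ('g, 'x, 'a) ric_functor
      \<Rightarrow> ('g, 'x, 'd \<Rightarrow> 'a) ric_functor" where
  "ric_Hom S D F = \<lparr>
     Obj = (\<lambda>x. tg_Hom (Obj D x) (Obj F x)),
     Res = (\<lambda>y x f. \<lambda>d\<in>carrier (Obj D y).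
       Res F y x (f (inv_into (carrier (Obj D x)) (Res D y x) d))),
     Ind = (\<lambda>x y f. \<lambda>d\<in>carrier (Obj D x).
       Ind F x y (f (inv_into (carrier (Obj D y)) (Ind D x y) d))),
     Con = (\<lambda>g x f. \<lambda>d\<in>carrier (Obj D (Act S g x)).
       Con F g x (f (inv_into (carrier (Obj D x)) (Con D g x) d)))\<rparr>"

definition const_functor :: "'a tgroup \<Rightarrow> ('g, 'x, 'a) ric_functor" where
  "const_functor A = \<lparr>Obj = (\<lambda>_. A), Res = (\<lambda>_ _ a. a), Ind = (\<lambda>_ _ a. a), Con = (\<lambda>_ _ a. a)\<rparr>"

definition discrete_integer_group :: "int tgroup" where
  "discrete_integer_group = \<lparr>carrier = carrier integer_group, mult = mult integer_group,
     one = one integer_group, topol = discrete_topology UNIV\<rparr>"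

definition conj_set :: "'g tgroup \<Rightarrow> 'g \<Rightarrow> 'g set \<Rightarrow> 'g set" where
  "conj_set G g H = (g <#\<^bsub>G\<^esub> H) #>\<^bsub>G\<^esub> (inv\<^bsub>G\<^esub> g)"

definition subgroup_system :: "'g tgroup \<Rightarrow> ('g, 'g set) ric_domain \<Rightarrow> bool" where
  "subgroup_system G S \<longleftrightarrow> ric_domain G S \<and>
     (\<forall>H\<in>Base S. subgroup H G \<and> (\<forall>g\<in>carrier G. Act S g H = conj_set G g H) \<and>
        (\<forall>I\<in>DRes S H \<union> DInd S H. I \<subseteq> H))"

definition Grp2 :: "'g tgroup \<Rightarrow> ('g set \<times> 'g set) set" where
  "Grp2 G = {(H, U). closed_subgroup H G \<and> closed_subgroup U G \<and> U \<lhd> (tg_sub G H)}"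

definition subgroup_system2 :: "'g tgroup \<Rightarrow> ('g, 'g set \<times> 'g set) ric_domain \<Rightarrow> bool" where
  "subgroup_system2 G E \<longleftrightarrow> ric_domain G E \<and> Base E \<subseteq> Grp2 G \<and>
     (\<forall>(H, U)\<in>Base E.
        (\<forall>g\<in>carrier G. Act E g (H, U) = (conj_set G g H, conj_set G g U)) \<and>
        (\<forall>(I, V)\<in>DRes E (H, U) \<union> DInd E (H, U). I \<subseteq> H \<and> V \<subseteq> U))"

definition Ext :: "('g, 'g set \<times> 'g set) ric_domain \<Rightarrow> 'g set \<Rightarrow> 'g set set" where
  "Ext E H = {U. (H, U) \<in> Base E}"

definition flat ::
    "'g tgroup \<Rightarrow> ('g, 'g set \<times> 'g set) ric_domain \<Rightarrow> ('g, 'g set) ric_domain" where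
  "flat G E = \<lparr>
     Base = fst ` Base E,
     Act = conj_set G,
     DRes = (\<lambda>H. fst ` (\<Union>U\<in>Ext E H. DRes E (H, U))),
     DInd = (\<lambda>H. fst ` (\<Union>U\<in>Ext E H. DInd E (H, U)))\<rparr>"

definition finite_index :: "'g tgroup \<Rightarrow> 'g set \<Rightarrow> 'g set \<Rightarrow> bool" where
  "finite_index G H I \<longleftrightarrow> finite (rcosets\<^bsub>tg_sub G H\<^esub> I)"

definition spectrum :: "'g tgroup \<Rightarrow> ('g, 'g set \<times> 'g set) ric_domain \<Rightarrow> bool" where
  "spectrum G E \<longleftrightarrow> subgroup_system2 G E \<and> subgroup_system G (flat G E) \<and>
     (\<forall>(H, U)\<in>Base E. \<forall>(I, V)\<in>DRes E (H, U). V = U) \<and>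
     (\<forall>H\<in>Base (flat G E). \<forall>I\<in>DRes (flat G E) H. finite_index G H I)"

definition lift_functor ::
    "('g, 'g set, 'a) ric_functor \<Rightarrow> ('g, 'g set \<times> 'g set, 'a) ric_functor" where
  "lift_functor C = \<lparr>
     Obj = (\<lambda>x. Obj C (fst x)),
     Res = (\<lambda>y x. Res C (fst y) (fst x)),
     Ind = (\<lambda>x y. Ind C (fst x) (fst y)),
     Con = (\<lambda>g x. Con C g (fst x))\<rparr>"

text \<open>\<open>ric_quotient E (lift_functor C) \<Phi>\<close> is a representation of the spectrum \<open>E\<close>.\<close>

definition spectrum_representation ::
    "'g tgroup \<Rightarrow> ('g, 'g set \<times> 'g set) ric_domain \<Rightarrow> ('g, 'g set, 'c) ric_functor
      \<Rightarrow> ('g set \<times> 'g set \<Rightarrow> 'c set) \<Rightarrow> bool" where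
  "spectrum_representation G E C \<Phi> \<longleftrightarrow> ric_functor G (flat G E) C \<and> ric_subfunctor G E (lift_functor C) \<Phi>"

definition right_transversal :: "'g tgroup \<Rightarrow> 'g set \<Rightarrow> 'g set \<Rightarrow> 'g list \<Rightarrow> bool" where
  "right_transversal G H I ts \<longleftrightarrow> distinct ts \<and> set ts \<subseteq> H \<and>
     bij_betw (\<lambda>t. I #>\<^bsub>G\<^esub> t) (set ts) (rcosets\<^bsub>tg_sub G H\<^esub> I)"

definition transversal_part :: "'g tgroup \<Rightarrow> 'g set \<Rightarrow> 'g list \<Rightarrow> 'g \<Rightarrow> 'g" where
  "transversal_part G I ts x = (THE k. k \<in> I \<and> (\<exists>t\<in>set ts. x = k \<otimes>\<^bsub>G\<^esub> t))"

text \<open>The value \<open>transfer G H I N h\<close> does not depend on the choice of the transversal when \<open>I / N\<close>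
  is abelian.\<close>

definition transfer :: "'g tgroup \<Rightarrow> 'g set \<Rightarrow> 'g set \<Rightarrow> 'g set \<Rightarrow> 'g \<Rightarrow> 'g set" where
  "transfer G H I N h = (let ts = (SOME ts. right_transversal G H I ts) in
     N #>\<^bsub>G\<^esub> foldr (\<otimes>\<^bsub>G\<^esub>) (map (\<lambda>t. transversal_part G I ts (t \<otimes>\<^bsub>G\<^esub> h)) ts) \<one>\<^bsub>G\<^esub>)"

definition abelianization_system ::
    "'g tgroup \<Rightarrow> ('g, 'g set) ric_domain \<Rightarrow> ('g set \<Rightarrow> 'g set) \<Rightarrow> bool" where
  "abelianization_system G S R \<longleftrightarrow> subgroup_system G S \<and>
     (\<forall>H\<in>Base S.
        closed_subgroup H G \<and>
        (\<forall>I\<in>DRes S H. finite_index G H I) \<and>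
        closed_subgroup (R H) G \<and> R H \<lhd> (tg_sub G H) \<and> comm_group (tg_sub G H Mod R H) \<and>
        (\<forall>g\<in>carrier G. R (conj_set G g H) = conj_set G g (R H)) \<and>
        (\<forall>I\<in>DRes S H. R H \<subseteq> kernel (tg_sub G H) (tg_sub G I Mod R I) (transfer G H I (R I))) \<and>
        (\<forall>I\<in>DInd S H. R I \<subseteq> R H))"

definition dualizing_functor ::
    "'g tgroup \<Rightarrow> ('g, 'g set) ric_domain \<Rightarrow> ('g, 'g set, 'd) ric_functor \<Rightarrow> bool" where
  "dualizing_functor G S D \<longleftrightarrow> ric_functor G S D \<and>
     (\<forall>H\<in>Base S. locally_compact_abelian_group (Obj D H) \<and>
        (\<forall>I\<in>DRes S H. Res D I H \<in> tg_iso (Obj D H) (Obj D I)) \<and>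
        (\<forall>I\<in>DInd S H. Ind D H I \<in> tg_iso (Obj D I) (Obj D H)))"

definition classification_datum ::
    "'g tgroup \<Rightarrow> ('g, 'g set \<times> 'g set) ric_domain \<Rightarrow> ('g set \<Rightarrow> 'g set)
      \<Rightarrow> ('g, 'g set, 'd) ric_functor \<Rightarrow> bool" where
  "classification_datum G E R D \<longleftrightarrow> spectrum G E \<and> abelianization_system G (flat G E) R \<and>
     dualizing_functor G (flat G E) D"

definition Pi_functor ::
    "'g tgroup \<Rightarrow> ('g set \<Rightarrow> 'g set) \<Rightarrow> ('g, 'g set \<times> 'g set, 'g set) ric_functor" where
  "Pi_functor G R = \<lparr>
     Obj = (\<lambda>(H, U). tg_quot (tg_sub G H) (U <#>\<^bsub>G\<^esub> R H)),
     Res = (\<lambda>(I, V) (H, U). quot_induced (transfer G H I (V <#>\<^bsub>G\<^esub> R I))),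
     Ind = (\<lambda>(H, U) (I, V). quot_induced (\<lambda>h. (U <#>\<^bsub>G\<^esub> R H) #>\<^bsub>G\<^esub> h)),
     Con = (\<lambda>g (H, U). quot_induced (\<lambda>h.
       (conj_set G g U <#>\<^bsub>G\<^esub> R (conj_set G g H)) #>\<^bsub>G\<^esub> (g \<otimes>\<^bsub>G\<^esub> h \<otimes>\<^bsub>G\<^esub> inv\<^bsub>G\<^esub> g)))\<rparr>"

definition Ext_R ::
    "('g, 'g set \<times> 'g set) ric_domain \<Rightarrow> ('g set \<Rightarrow> 'g set) \<Rightarrow> 'g set \<Rightarrow> 'g set set" where
  "Ext_R E R H = {U \<in> Ext E H. R H \<subseteq> U}"

definition R_lattice ::
    "'g tgroup \<Rightarrow> ('g, 'g set \<times> 'g set) ric_domain \<Rightarrow> ('g set \<Rightarrow> 'g set)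
      \<Rightarrow> ('g set \<Rightarrow> 'g set set) \<Rightarrow> bool" where
  "R_lattice G E R L \<longleftrightarrow> (\<forall>H\<in>Base (flat G E). L H \<subseteq> Ext_R E R H \<and>
     (\<forall>U1\<in>L H. \<forall>U2\<in>L H. U1 <#>\<^bsub>G\<^esub> U2 \<in> L H \<and> U1 \<inter> U2 \<in> L H))"

definition L_coherent ::
    "'g tgroup \<Rightarrow> ('g, 'g set \<times> 'g set) ric_domain \<Rightarrow> ('g set \<Rightarrow> 'g set)
      \<Rightarrow> ('g, 'g set, 'd) ric_functor \<Rightarrow> bool" where
  "L_coherent G E R D \<longleftrightarrow> (\<forall>H\<in>Base (flat G E). \<forall>U1\<in>Ext_R E R H. \<forall>U2\<in>Ext_R E R H. U2 \<subseteq> U1 \<longrightarrow>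
     (H, U2) \<in> DInd E (H, U1) \<and>
     (carrier (tg_Hom (Obj D H) (tg_quot (tg_sub G U1) U2)) =
        {\<one>\<^bsub>tg_Hom (Obj D H) (tg_quot (tg_sub G U1) U2)\<^esub>} \<longrightarrow> U1 = U2))"

end

theory Submission
  imports Defs "HOL-Algebra.Zassenhaus"
begin

text \<open>Fix \<open>H\<close>. For \<open>U2 \<subseteq> U1\<close> the map \<open>ind\<close> from \<open>(H, U2)\<close> to \<open>(H, U1)\<close> is composition with the
  projection \<open>H / U2 R(H) \<rightarrow> H / U1 R(H)\<close> on \<open>Hom(D, \<Pi>)\<close>, and the projection
  \<open>C(H) / \<Phi>(H, U2) \<rightarrow> C(H) / \<Phi>(H, U1)\<close> on the representation. Comparing kernels through \<open>\<theta>\<close> gives: if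
  \<open>\<theta> (H, U2) f\<close> is the coset of \<open>c\<close>, then \<open>c \<in> \<Phi>(H, U1)\<close> iff \<open>f\<close> takes values in \<open>U1 R(H) / U2 R(H)\<close>. This
  translates every statement on the groups \<open>\<Phi>(H, U)\<close> into one on homomorphisms: intersections are
  immediate, and products amount to splitting a continuous homomorphism into
  \<open>U1 U2 / (U1 \<inter> U2) = U1 / (U1 \<inter> U2) \<times> U2 / (U1 \<inter> U2)\<close> into its two components, which are continuous
  because the groups are compact. Topologically, \<open>\<Phi>(H, U)\<close> is closed (open) because the
  trivial homomorphism is a closed (open) point of the compact-open topology.\<close>

subsection \<open>Subgroups and quotients of topological groups\<close>

lemma tg_sub_sel [simp]:
  "carrier (tg_sub G H) = H" "x \<otimes>\<^bsub>tg_sub G H\<^esub> y = x \<otimes>\<^bsub>G\<^esub> y" "\<one>\<^bsub>tg_sub G H\<^esub> = \<one>\<^bsub>G\<^esub>"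
  "topol (tg_sub G H) = subtopology (topol G) H"
  by (auto simp: tg_sub_def)

lemma tg_sub_cosets [simp]:
  "N #>\<^bsub>tg_sub G H\<^esub> x = N #>\<^bsub>G\<^esub> x" "A <#>\<^bsub>tg_sub G H\<^esub> B = A <#>\<^bsub>G\<^esub> B"
  by (auto simp: r_coset_def set_mult_def)

lemma tg_sub_tg_sub: "M \<subseteq> H \<Longrightarrow> tg_sub (tg_sub G H) M = tg_sub G M"
  by (auto simp: tg_sub_def subtopology_subtopology Int_absorb1)

lemma tg_quot_sel [simp]:
  "carrier (tg_quot G N) = rcosets\<^bsub>G\<^esub> N" "X \<otimes>\<^bsub>tg_quot G N\<^esub> Y = X <#>\<^bsub>G\<^esub> Y" "\<one>\<^bsub>tg_quot G N\<^esub> = N"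
  "topol (tg_quot G N) = quot_topology G N"
  by (auto simp: tg_quot_def FactGroup_def)

lemma rcosets_eq_image: "rcosets\<^bsub>G\<^esub> N = (\<lambda>x. N #>\<^bsub>G\<^esub> x) ` carrier G"
  by (auto simp: RCOSETS_def)

lemma tg_Hom_sel [simp]:
  "carrier (tg_Hom A B) = tg_Hom_set A B"
  "f \<otimes>\<^bsub>tg_Hom A B\<^esub> g = (\<lambda>a\<in>carrier A. f a \<otimes>\<^bsub>B\<^esub> g a)"
  by (auto simp: tg_Hom_def)

lemma tg_Hom_one: "\<one>\<^bsub>tg_Hom A B\<^esub> = (\<lambda>a\<in>carrier A. \<one>\<^bsub>B\<^esub>)"
  by (simp add: tg_Hom_def)

section \<open>Cosets and products of subgroups\<close>

context group
begin

lemma rcos_eq_iff: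
  assumes "subgroup N G" "x \<in> carrier G" "y \<in> carrier G"
  shows "N #> x = N #> y \<longleftrightarrow> x \<otimes> inv y \<in> N"
  by (metis assms coset_join1 coset_join2 coset_mult_inv1 coset_mult_inv2 inv_closed m_closed
      subgroup.subset)

lemma rcos_eq_self_iff:
  assumes "subgroup N G" "x \<in> carrier G"
  shows "N #> x = N \<longleftrightarrow> x \<in> N"
  using assms coset_join1 coset_join2 by blast

lemma rcos_subset_iff:
  assumes "subgroup N G" "subgroup M G" "N \<subseteq> M" "x \<in> carrier G"
  shows "N #> x \<subseteq> M \<longleftrightarrow> x \<in> M"
  using assms rcos_self[of x N]
  by (auto simp: r_coset_def subgroup.m_closed subset_iff)

text \<open>Multiplication by \<open>M\<close> is the projection from cosets of \<open>N\<close> to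
  cosets of \<open>M\<close>; \<open>rcos_factor\<close> uses it to read off a component.\<close>

lemma rcos_subset_cancel:
  assumes "subgroup N G" "subgroup M G" "N \<subseteq> M" "x \<in> carrier G"
  shows "M <#> (N #> x) = M #> x"
proof -
  have "M <#> N = M"
    using assms by (auto simp: set_mult_def subgroup.m_closed subset_iff)
      (metis subgroup.one_closed r_one subgroup.mem_carrier)
  then show ?thesis
    using assms by (simp add: setmult_rcos_assoc subgroup.subset)
qed

lemma normal_set_mult:
  assumes M: "M \<lhd> G" and N: "N \<lhd> G"
  shows "M <#> N \<lhd> G"
proof (rule normal_invI)
  note sub = normal_imp_subgroup[OF M] normal_imp_subgroup[OF N]
  show "subgroup (M <#> N) G"
    using M sub(2) by (rule mult_norm_subgroup)
  fix x h assume x: "x \<in> carrier G" and "h \<in> M <#> N"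
  then obtain m n where h: "h = m \<otimes> n" and m: "m \<in> M" and n: "n \<in> N"
    by (auto simp: set_mult_def)
  have mn: "m \<in> carrier G" "n \<in> carrier G"
    using subgroup.mem_carrier[OF sub(1) m] subgroup.mem_carrier[OF sub(2) n] .
  \<comment> \<open>Inserting \<open>inv x \<otimes> x\<close> between \<open>m\<close> and
    \<open>n\<close> turns the conjugate of the product into the product of the conjugates.\<close>
  have "inv x \<otimes> (x \<otimes> (n \<otimes> inv x)) = n \<otimes> inv x"
    using x mn by (simp add: m_assoc[symmetric])
  then have "x \<otimes> h \<otimes> inv x = (x \<otimes> m \<otimes> inv x) \<otimes> (x \<otimes> n \<otimes> inv x)"
    using x mn by (simp add: h m_assoc)
  moreover have "x \<otimes> m \<otimes> inv x \<in> M" "x \<otimes> n \<otimes> inv x \<in> N"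
    using normal_invE(2)[OF M x m] normal_invE(2)[OF N x n] .
  ultimately show "x \<otimes> h \<otimes> inv x \<in> M <#> N"
    by (auto simp: set_mult_def)
qed

lemma subset_set_mult:
  assumes "subgroup M G" "subgroup N G"
  shows "M \<subseteq> M <#> N" "N \<subseteq> M <#> N"
proof -
  have "\<one> \<in> M" "\<one> \<in> N" "M \<subseteq> carrier G" "N \<subseteq> carrier G"
    using assms by (auto simp: subgroup.one_closed subgroup.subset)
  then show "M \<subseteq> M <#> N" "N \<subseteq> M <#> N"
    unfolding set_mult_def by force+
qed

lemma set_mult_subset_subgroup:
  assumes "subgroup M G" "A \<subseteq> M" "B \<subseteq> M"
  shows "A <#> B \<subseteq> M"
  using assms by (auto simp: set_mult_def subgroup.m_closed subset_iff)

lemma set_mult_absorb: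
  assumes "subgroup M G" "subgroup N G" "N \<subseteq> M"
  shows "M <#> N = M"
  using assms subset_set_mult set_mult_subset_subgroup by (simp add: subset_antisym)

end

lemma group_tg_quot:
  assumes "group T" "N \<lhd> T"
  shows "group (tg_quot T N)"
proof -
  interpret Q: group "T Mod N"
    using assms normal.factorgroup_is_group by blast
  show ?thesis
    using Q.l_inv_ex Q.m_closed Q.one_closed Q.l_one Q.m_assoc
    by (intro groupI) (auto simp: FactGroup_def)
qed

section \<open>Quotient topologies and translations\<close>

lemma (in topological_group) topspace_quot_topology:
  assumes "N \<subseteq> carrier G"
  shows "topspace (quot_topology G N) = rcosets N"
proof -
  have "{x \<in> carrier G. N #> x \<in> rcosets N} = carrier G"
    using assms rcosetsI by blast
  then have "openin (quot_topology G N) (rcosets N)"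
    using topspace_topol openin_topspace[of "topol G"] by (simp add: openin_quot_topology)
  moreover have "topspace (quot_topology G N) \<subseteq> rcosets N"
    using openin_quot_topology[OF topspace_topol] by blast
  ultimately show ?thesis
    using openin_subset by blast
qed

lemma (in topological_group) closedin_quot_topology:
  assumes "N \<subseteq> carrier G"
  shows "closedin (quot_topology G N) S \<longleftrightarrow>
    S \<subseteq> rcosets N \<and> closedin (topol G) {x \<in> carrier G. N #> x \<in> S}"
proof -
  have "carrier G - {x \<in> carrier G. N #> x \<in> S} = {x \<in> carrier G. N #> x \<in> rcosets N - S}"
    using assms rcosetsI by blast
  then show ?thesis
    using assms by (auto simp: closedin_def topspace_quot_topology topspace_topol openin_quot_topology)
qed

text \<open>The preimage of the trivial coset is \<open>N\<close> itself. This and its closed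
  analogue are used in both directions: to make the unit of \<open>Q U\<close> open or closed, and
  to return from the unit of \<open>Z U\<close> to \<open>\<Phi> (H, U)\<close>.\<close>

lemma (in topological_group) open_one_quot_iff:
  assumes "subgroup N G"
  shows "openin (quot_topology G N) {N} \<longleftrightarrow> openin (topol G) N"
proof -
  have "{x \<in> carrier G. N #> x \<in> {N}} = N"
    using subgroup.subset[OF assms] by (simp add: rcos_eq_self_iff[OF assms] cong: conj_cong) blast
  moreover have "N \<in> rcosets N"
    using subgroup.subgroup_in_rcosets[OF assms is_group] .
  ultimately show ?thesis
    by (simp add: openin_quot_topology topspace_topol)
qed

lemma (in topological_group) closed_one_quot_iff:
  assumes "subgroup N G"
  shows "closedin (quot_topology G N) {N} \<longleftrightarrow> closedin (topol G) N"
proof -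
  have "{x \<in> carrier G. N #> x \<in> {N}} = N"
    using subgroup.subset[OF assms] by (simp add: rcos_eq_self_iff[OF assms] cong: conj_cong) blast
  moreover have "N \<in> rcosets N"
    using subgroup.subgroup_in_rcosets[OF assms is_group] .
  ultimately show ?thesis
    using assms by (simp add: closedin_quot_topology subgroup.subset)
qed

lemma (in topological_group) continuous_map_rtranslation:
  assumes "a \<in> carrier G"
  shows "continuous_map (topol G) (topol G) (\<lambda>x. x \<otimes> a)"
proof -
  have "continuous_map (topol G) (prod_topology (topol G) (topol G)) (\<lambda>x. (x, a))"
    using assms by (simp add: continuous_map_pairwise o_def topspace_topol)
  from continuous_map_compose[OF this continuous_mult] show ?thesis
    by (simp add: o_def)
qed

lemma (in topological_group) openin_set_mult:
  assumes "openin (topol G) A" "B \<subseteq> carrier G"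
  shows "openin (topol G) (A <#> B)"
proof -
  have A: "A \<subseteq> carrier G"
    using assms openin_subset topspace_topol by metis
  \<comment> \<open>The product is a union of translates of \<open>A\<close>, each the preimage of
    \<open>A\<close> under a right translation.\<close>
  have "A <#> B = (\<Union>b\<in>B. {x \<in> topspace (topol G). x \<otimes> inv b \<in> A})"
  proof (intro equalityI subsetI)
    fix x assume "x \<in> A <#> B"
    then obtain a b where "x = a \<otimes> b" "a \<in> A" "b \<in> B" by (auto simp: set_mult_def)
    then show "x \<in> (\<Union>b\<in>B. {x \<in> topspace (topol G). x \<otimes> inv b \<in> A})"
      using A assms(2) by (auto simp: topspace_topol m_assoc subset_iff intro!: bexI[of _ b])
  next
    fix x assume "x \<in> (\<Union>b\<in>B. {x \<in> topspace (topol G). x \<otimes> inv b \<in> A})"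
    then obtain b where "b \<in> B" "x \<in> carrier G" "x \<otimes> inv b \<in> A" by (auto simp: topspace_topol)
    then show "x \<in> A <#> B"
      using assms(2) unfolding set_mult_def
      by (intro UN_I[of "x \<otimes> inv b"] UN_I[of b]) (auto simp: m_assoc subset_iff)
  qed
  then show ?thesis
    using assms by (auto intro!: openin_Union openin_continuous_map_preimage[OF continuous_map_rtranslation])
qed

lemma (in topological_group) topological_group_tg_sub:
  assumes "subgroup H G"
  shows "topological_group (tg_sub G H)"
proof -
  have H: "H \<subseteq> carrier G" using assms subgroup.subset by blast
  have g: "group (tg_sub G H)"
  proof (rule groupI)
    fix x assume "x \<in> carrier (tg_sub G H)"
    then have "x \<in> carrier G" "inv x \<in> H"
      using H assms by (auto simp: subgroup.m_inv_closed)
    then show "\<exists>y\<in>carrier (tg_sub G H). y \<otimes>\<^bsub>tg_sub G H\<^esub> x = \<one>\<^bsub>tg_sub G H\<^esub>"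
      by (intro bexI[of _ "inv x"]) auto
  qed (use subsetD[OF H] assms in \<open>auto simp: subgroup.m_closed subgroup.one_closed m_assoc\<close>)
  \<comment> \<open>Inverses are defined relative to the carrier, so agreement with those of
    \<open>G\<close> has to be shown on \<open>H\<close> before continuity can be
    transferred.\<close>
  have inv: "inv\<^bsub>tg_sub G H\<^esub> x = inv x" if "x \<in> H" for x
    using assms that subsetD[OF H] by (intro group.inv_equality[OF g]) (auto simp: subgroup.m_inv_closed)
  show ?thesis
  proof (intro topological_group.intro topological_group_axioms.intro g)
    show "topspace (topol (tg_sub G H)) = carrier (tg_sub G H)"
      using H topspace_topol by (auto simp: topspace_subtopology)
    have "continuous_map (subtopology (prod_topology (topol G) (topol G)) (H \<times> H)) (subtopology (topol G) H)
        (\<lambda>(x, y). x \<otimes> y)"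
      using continuous_mult assms
      by (auto simp: continuous_map_in_subtopology subgroup.m_closed intro: continuous_map_from_subtopology)
    then show "continuous_map (prod_topology (topol (tg_sub G H)) (topol (tg_sub G H)))
       (topol (tg_sub G H)) (\<lambda>(x, y). x \<otimes>\<^bsub>tg_sub G H\<^esub> y)"
      by (simp add: subtopology_Times)
    have "continuous_map (subtopology (topol G) H) (subtopology (topol G) H) (\<lambda>x. inv x)"
      using continuous_inv assms
      by (auto simp: continuous_map_in_subtopology subgroup.m_inv_closed intro: continuous_map_from_subtopology)
    then show "continuous_map (topol (tg_sub G H)) (topol (tg_sub G H)) (\<lambda>x. inv\<^bsub>tg_sub G H\<^esub> x)"
      unfolding tg_sub_sel by (rule continuous_map_eq) (auto simp: inv)
  qed
qed

section \<open>Compact groups\<close>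

locale compact_group = topological_group +
  assumes compact: "compact_space (topol G)" and Hausdorff: "Hausdorff_space (topol G)"
begin

lemma compact_group_tg_sub:
  assumes "closed_subgroup H G"
  shows "compact_group (tg_sub G H)"
  using assms compact Hausdorff topological_group_tg_sub
  by (simp add: closed_subgroup_def compact_group_def compact_group_axioms_def Hausdorff_space_subtopology
      closedin_compact_space compact_space_subtopology)

text \<open>The product is the continuous image of the compact set \<open>A \<times> B\<close>, and
  compact sets are closed in a Hausdorff space.\<close>

lemma closedin_set_mult:
  assumes "closedin (topol G) A" "closedin (topol G) B"
  shows "closedin (topol G) (A <#> B)"
proof -
  have "compactin (prod_topology (topol G) (topol G)) (A \<times> B)"
    using assms compact by (simp add: compactin_Times closedin_compact_space)
  from image_compactin[OF this continuous_mult]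
  have "compactin (topol G) ((\<lambda>(x, y). x \<otimes> y) ` (A \<times> B))" .
  moreover have "(\<lambda>(x, y). x \<otimes> y) ` (A \<times> B) = A <#> B"
    by (auto simp: set_mult_def)
  ultimately show ?thesis
    using Hausdorff compactin_imp_closedin by metis
qed

end

subsection \<open>The compact-open topology on homomorphisms\<close>

lemma tg_Hom_setI:
  assumes "\<And>x. x \<in> carrier A \<Longrightarrow> f x \<in> carrier B"
    and "\<And>x y. \<lbrakk>x \<in> carrier A; y \<in> carrier A\<rbrakk> \<Longrightarrow> f (x \<otimes>\<^bsub>A\<^esub> y) = f x \<otimes>\<^bsub>B\<^esub> f y"
    and "continuous_map (topol A) (topol B) f" and "f \<in> extensional (carrier A)"
  shows "f \<in> tg_Hom_set A B"
  using assms by (auto simp: tg_Hom_set_def tg_hom_def hom_def)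

lemma tg_Hom_setD:
  assumes "f \<in> tg_Hom_set A B"
  shows "\<And>x. x \<in> carrier A \<Longrightarrow> f x \<in> carrier B"
    and "\<And>x y. \<lbrakk>x \<in> carrier A; y \<in> carrier A\<rbrakk> \<Longrightarrow> f (x \<otimes>\<^bsub>A\<^esub> y) = f x \<otimes>\<^bsub>B\<^esub> f y"
    and "continuous_map (topol A) (topol B) f" and "f \<in> extensional (carrier A)"
  using assms by (auto simp: tg_Hom_set_def tg_hom_def hom_def)

lemma tg_Hom_one_closed:
  assumes "topspace (topol A) = carrier A" "group A" "group B" "topspace (topol B) = carrier B"
  shows "\<one>\<^bsub>tg_Hom A B\<^esub> \<in> carrier (tg_Hom A B)"
proof -
  interpret A: group A by fact
  interpret B: group B by fact
  have "continuous_map (topol A) (topol B) (\<lambda>a\<in>carrier A. \<one>\<^bsub>B\<^esub>)"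
    by (rule continuous_map_eq[of _ _ "\<lambda>_. \<one>\<^bsub>B\<^esub>"]) (use assms in auto)
  then show ?thesis
    by (auto simp: tg_Hom_one intro!: tg_Hom_setI)
qed

lemma tg_Hom_one_eqI:
  assumes "f \<in> tg_Hom_set A B" "\<And>d. d \<in> carrier A \<Longrightarrow> f d = \<one>\<^bsub>B\<^esub>"
  shows "f = \<one>\<^bsub>tg_Hom A B\<^esub>"
  using assms tg_Hom_setD(4)[OF assms(1)] by (auto simp: tg_Hom_one extensional_def fun_eq_iff)

lemma openin_tg_Hom:
  assumes "compactin (topol A) K" "openin (topol B) V"
  shows "openin (topol (tg_Hom A B)) {f \<in> tg_Hom_set A B. f ` K \<subseteq> V}"
  using assms by (auto simp: tg_Hom_def intro!: topology_generated_by_Basis)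

lemma topspace_tg_Hom: "topspace (topol (tg_Hom A B)) = tg_Hom_set A B"
proof -
  \<comment> \<open>For empty \<open>K\<close> the condition on \<open>f\<close> is void, so the set
    of all homomorphisms is itself subbasic.\<close>
  have "openin (topol (tg_Hom A B)) (tg_Hom_set A B)"
    using openin_tg_Hom[of A "{}" B "{}"] by simp
  moreover have "topspace (topol (tg_Hom A B)) \<subseteq> tg_Hom_set A B"
    by (auto simp: tg_Hom_def topology_generated_by_topspace)
  ultimately show ?thesis
    using openin_subset by blast
qed

text \<open>A non-trivial homomorphism sends some point into the open complement of the unit.
  Singletons are compact, so the non-trivial homomorphisms form a union of subbasic open
  sets.\<close>

lemma closedin_tg_Hom_one:
  assumes "topspace (topol A) = carrier A" "group A" "group B"
    and B: "topspace (topol B) = carrier B" "closedin (topol B) {\<one>\<^bsub>B\<^esub>}"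
  shows "closedin (topol (tg_Hom A B)) {\<one>\<^bsub>tg_Hom A B\<^esub>}"
proof -
  let ?V = "topspace (topol B) - {\<one>\<^bsub>B\<^esub>}"
  have "f \<noteq> \<one>\<^bsub>tg_Hom A B\<^esub> \<longleftrightarrow> (\<exists>d\<in>carrier A. f d \<in> ?V)" if f: "f \<in> tg_Hom_set A B" for f
  proof
    assume "f \<noteq> \<one>\<^bsub>tg_Hom A B\<^esub>"
    then obtain d where "d \<in> carrier A" "f d \<noteq> \<one>\<^bsub>B\<^esub>"
      using tg_Hom_one_eqI[OF f] by blast
    then show "\<exists>d\<in>carrier A. f d \<in> ?V"
      using tg_Hom_setD(1)[OF f] B(1) by blast
  qed (auto simp: tg_Hom_one)
  then have "tg_Hom_set A B - {\<one>\<^bsub>tg_Hom A B\<^esub>} = (\<Union>d\<in>carrier A. {f \<in> tg_Hom_set A B. f ` {d} \<subseteq> ?V})"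
    by auto
  moreover have "openin (topol (tg_Hom A B)) \<dots>"
  proof (intro openin_Union ballI)
    fix S assume "S \<in> (\<lambda>d. {f \<in> tg_Hom_set A B. f ` {d} \<subseteq> ?V}) ` carrier A"
    then obtain d where d: "d \<in> carrier A" and S: "S = {f \<in> tg_Hom_set A B. f ` {d} \<subseteq> ?V}"
      by blast
    have "compactin (topol A) {d}"
      using d assms(1) by simp
    then show "openin (topol (tg_Hom A B)) S"
      unfolding S using B(2) by (intro openin_tg_Hom) blast+
  qed
  ultimately have "openin (topol (tg_Hom A B)) (tg_Hom_set A B - {\<one>\<^bsub>tg_Hom A B\<^esub>})"
    by (simp only:)
  moreover have "\<one>\<^bsub>tg_Hom A B\<^esub> \<in> tg_Hom_set A B"
    using tg_Hom_one_closed[OF assms(1-4)] by simp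
  ultimately show ?thesis
    by (simp add: closedin_def topspace_tg_Hom)
qed

text \<open>The set \<open>K\<close> detects triviality: the subbasic set of those \<open>f\<close>
  that map \<open>K\<close> into the open unit point contains only the trivial homomorphism.\<close>

lemma openin_tg_Hom_one:
  assumes "topspace (topol A) = carrier A" "group A" "group B" "topspace (topol B) = carrier B"
    and B: "openin (topol B) {\<one>\<^bsub>B\<^esub>}" and K: "compactin (topol A) K"
    and gen: "\<And>f. \<lbrakk>f \<in> tg_Hom_set A B; \<forall>d\<in>K. f d = \<one>\<^bsub>B\<^esub>\<rbrakk> \<Longrightarrow> \<forall>d\<in>carrier A. f d = \<one>\<^bsub>B\<^esub>"
  shows "openin (topol (tg_Hom A B)) {\<one>\<^bsub>tg_Hom A B\<^esub>}"
proof -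
  have "K \<subseteq> carrier A"
    using K assms(1) compactin_subset_topspace by metis
  then have "\<one>\<^bsub>tg_Hom A B\<^esub> ` K \<subseteq> {\<one>\<^bsub>B\<^esub>}"
    by (auto simp: tg_Hom_one)
  moreover have "f = \<one>\<^bsub>tg_Hom A B\<^esub>" if "f \<in> tg_Hom_set A B" "f ` K \<subseteq> {\<one>\<^bsub>B\<^esub>}" for f
    using gen[OF that(1)] that(2) by (intro tg_Hom_one_eqI[OF that(1)]) blast
  ultimately have "{\<one>\<^bsub>tg_Hom A B\<^esub>} = {f \<in> tg_Hom_set A B. f ` K \<subseteq> {\<one>\<^bsub>B\<^esub>}}"
    using tg_Hom_one_closed[OF assms(1-4)] unfolding tg_Hom_sel by blast
  then show ?thesis
    using openin_tg_Hom[OF K B] by (simp only:)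
qed

subsection \<open>Homomorphisms into subquotients of compact groups\<close>

lemma (in topological_group) rcosets_tg_sub:
  assumes "subgroup N G" "subgroup M G" "N \<subseteq> M"
  shows "rcosets\<^bsub>tg_sub G M\<^esub> N = {X \<in> rcosets N. X \<subseteq> M}"
  using subgroup.subset[OF assms(2)] rcos_subset_iff[OF assms]
  by (auto simp: rcosets_eq_image)

text \<open>Closed sets are compared. As \<open>M\<close> is closed, on both sides they are the sets
  of cosets inside \<open>M\<close> whose union of representatives is closed in
  \<open>G\<close>.\<close>

lemma (in topological_group) quot_topology_tg_sub:
  assumes N: "subgroup N G" and M: "closed_subgroup M G" and NM: "N \<subseteq> M"
  shows "quot_topology (tg_sub G M) N = subtopology (quot_topology G N) {X \<in> rcosets N. X \<subseteq> M}"
proof -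
  have sub: "subgroup M G" and cl: "closedin (topol G) M" and MG: "M \<subseteq> carrier G"
    using M subgroup.subset by (auto simp: closed_subgroup_def)
  interpret S: topological_group "tg_sub G M"
    using sub by (rule topological_group_tg_sub)
  let ?Q = "{X \<in> rcosets N. X \<subseteq> M}"
  \<comment> \<open>A representative of a coset contained in \<open>M\<close> lies in
    \<open>M\<close>, so preimages taken in \<open>M\<close> and in \<open>G\<close>
    coincide.\<close>
  have pre: "{x \<in> M. N #> x \<in> S} = {x \<in> carrier G. N #> x \<in> S}" if "S \<subseteq> ?Q" for S
  proof -
    have "x \<in> M" if "x \<in> carrier G" "N #> x \<in> S" for x
      using that \<open>S \<subseteq> ?Q\<close> rcos_subset_iff[OF N sub NM that(1)] by blast
    then show ?thesis using MG by blast
  qed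
  have "{x \<in> carrier G. N #> x \<in> ?Q} = M"
    using pre[of ?Q] rcosetsI[OF subgroup.subset[OF N]] rcos_subset_iff[OF N sub NM] MG by blast
  then have clQ: "closedin (quot_topology G N) ?Q"
    using cl by (auto simp: closedin_quot_topology[OF subgroup.subset[OF N]])
  have "closedin (quot_topology (tg_sub G M) N) S \<longleftrightarrow> closedin (subtopology (quot_topology G N) ?Q) S" for S
  proof (cases "S \<subseteq> ?Q")
    case True
    then show ?thesis
      using MG NM cl pre[OF True] unfolding closedin_closed_subtopology[OF clQ]
      by (subst S.closedin_quot_topology)
        (auto simp: rcosets_tg_sub[OF N sub NM] closedin_quot_topology[OF subgroup.subset[OF N]]
          closedin_closed_subtopology)
  next
    case False
    then show ?thesis
      using NM unfolding closedin_closed_subtopology[OF clQ]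
      by (subst S.closedin_quot_topology) (auto simp: rcosets_tg_sub[OF N sub NM])
  qed
  moreover have "topspace (quot_topology (tg_sub G M) N) = topspace (subtopology (quot_topology G N) ?Q)"
    using NM by (subst S.topspace_quot_topology)
      (auto simp: rcosets_tg_sub[OF N sub NM] topspace_quot_topology[OF subgroup.subset[OF N]])
  ultimately show ?thesis
    by (simp only: topology_eq openin_closedin_eq simp_thms)
qed

text \<open>This makes the identification of homomorphisms into a subquotient with certain
  homomorphisms into the quotient an equality of sets of functions: products of cosets agree, and
  the smaller group carries the subspace topology.\<close>

lemma (in topological_group) tg_Hom_set_tg_sub:
  assumes "topspace (topol A) = carrier A"
    and N: "subgroup N G" and M: "closed_subgroup M G" and NM: "N \<subseteq> M"
  shows "tg_Hom_set A (tg_quot (tg_sub G M) N)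
    = {f \<in> tg_Hom_set A (tg_quot G N). \<forall>d\<in>carrier A. f d \<subseteq> M}"
proof -
  have sub: "subgroup M G"
    using M by (auto simp: closed_subgroup_def)
  show ?thesis
    using assms(1)
    by (auto simp: tg_Hom_set_def tg_hom_def hom_def rcosets_tg_sub[OF N sub NM] quot_topology_tg_sub[OF N M NM]
        continuous_map_in_subtopology Pi_iff)
qed

section \<open>Splitting homomorphisms into two components\<close>

lemma (in group) commuting_rcos:
  assumes M: "M \<lhd> G" and N: "N \<lhd> G" and mn: "m \<in> M" "n \<in> N"
  shows "(M \<inter> N) #> (m \<otimes> n) = (M \<inter> N) #> (n \<otimes> m)"
proof -
  note subs = normal_imp_subgroup[OF M] normal_imp_subgroup[OF N]
  have G: "m \<in> carrier G" "n \<in> carrier G"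
    using subgroup.mem_carrier[OF subs(1) mn(1)] subgroup.mem_carrier[OF subs(2) mn(2)] .
  \<comment> \<open>The commutator of \<open>m\<close> and \<open>n\<close> is bracketed in two
    ways: as \<open>m\<close> times a conjugate of \<open>inv m\<close> it lies in \<open>M\<close>,
    as a conjugate of \<open>n\<close> times \<open>inv n\<close> it lies in
    \<open>N\<close>.\<close>
  have e: "m \<otimes> n \<otimes> inv (n \<otimes> m) = m \<otimes> (n \<otimes> inv m \<otimes> inv n)"
    "m \<otimes> n \<otimes> inv (n \<otimes> m) = (m \<otimes> n \<otimes> inv m) \<otimes> inv n"
    using G by (simp_all add: inv_mult_group m_assoc)
  have "m \<otimes> n \<otimes> inv (n \<otimes> m) \<in> M"
    unfolding e(1) using G mn(1) subs(1) normal_invE(2)[OF M]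
    by (simp add: subgroup.m_closed subgroup.m_inv_closed)
  moreover have "m \<otimes> n \<otimes> inv (n \<otimes> m) \<in> N"
    unfolding e(2) using G mn(2) subs(2) normal_invE(2)[OF N]
    by (simp add: subgroup.m_closed subgroup.m_inv_closed)
  ultimately show ?thesis
    using G rcos_eq_iff[OF subgroups_Inter_pair[OF subs]] by simp
qed

text \<open>The \<open>N\<close>-component of a coset is recovered without choosing a factorization:
  multiplying by \<open>M\<close> removes \<open>m\<close>, and intersecting with \<open>N\<close>
  cuts \<open>M #> n\<close> down to a coset of \<open>M \<inter> N\<close>.\<close>

lemma (in group) rcos_factor:
  assumes M: "subgroup M G" and N: "subgroup N G" and mn: "m \<in> M" "n \<in> N"
  shows "(M <#> ((M \<inter> N) #> (m \<otimes> n))) \<inter> N = (M \<inter> N) #> n"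
proof -
  note MN = subgroups_Inter_pair[OF M N]
  have G: "m \<in> carrier G" "n \<in> carrier G" "M \<subseteq> carrier G"
    using subgroup.mem_carrier[OF M mn(1)] subgroup.mem_carrier[OF N mn(2)] subgroup.subset[OF M] .
  have "m \<otimes> n \<otimes> inv n \<in> M"
    using G mn by (simp add: m_assoc)
  then have "M #> (m \<otimes> n) = M #> n"
    using G rcos_eq_iff[OF M] by simp
  then have e: "M <#> ((M \<inter> N) #> (m \<otimes> n)) = M #> n"
    using G rcos_subset_cancel[OF MN M] by simp
  have "k \<in> N" if "k \<in> M" "k \<otimes> n \<in> N" for k
  proof -
    have "k \<otimes> n \<otimes> inv n \<in> N"
      using that mn N by (simp add: subgroup.m_closed subgroup.m_inv_closed)
    then show ?thesis
      using that G by (auto simp: m_assoc)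
  qed
  then show ?thesis
    unfolding e using N mn(2) by (auto simp: r_coset_def subgroup.m_closed)
qed

text \<open>The component is \<open>d \<mapsto> M f(d) \<inter> N\<close>. It is continuous because the preimage of a closed set \<open>S\<close> under
  it is the preimage under \<open>f\<close> of the image of \<open>M P\<close>, where \<open>P \<subseteq> N\<close> is the set of representatives of \<open>S\<close>
  in \<open>N\<close>, and products of closed sets are closed in a compact group.\<close>

lemma (in compact_group) tg_Hom_project:
  assumes M: "M \<lhd> G" "closedin (topol G) M" and N: "N \<lhd> G" "closedin (topol G) N"
    and A: "topspace (topol A) = carrier A" "group A"
    and f: "f \<in> tg_Hom_set A (tg_quot G (M \<inter> N))" "\<And>d. d \<in> carrier A \<Longrightarrow> f d \<subseteq> M <#> N"
  obtains g where "g \<in> tg_Hom_set A (tg_quot G (M \<inter> N))"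
    and "\<And>d m n. \<lbrakk>d \<in> carrier A; m \<in> M; n \<in> N; f d = (M \<inter> N) #> (m \<otimes> n)\<rbrakk> \<Longrightarrow> g d = (M \<inter> N) #> n"
proof -
  interpret A: group A by (rule A(2))
  define I where "I = M \<inter> N"
  note subs = normal_imp_subgroup[OF M(1)] normal_imp_subgroup[OF N(1)]
  have I: "I \<lhd> G"
    unfolding I_def using M(1) N(1) by (rule normal_subgroup_intersect)
  interpret I: normal I G by (rule I)
  have Isub: "subgroup I G" "I \<subseteq> carrier G" "I \<subseteq> M" "I \<subseteq> N"
    using I.subgroup_axioms I.subset by (auto simp: I_def)
  have MG: "M \<subseteq> carrier G" and NG: "N \<subseteq> carrier G"
    using subs subgroup.subset by auto
  define g where "g = (\<lambda>d\<in>carrier A. (M <#> f d) \<inter> N)"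
  have g: "g d = I #> n" if "d \<in> carrier A" "m \<in> M" "n \<in> N" "f d = I #> (m \<otimes> n)" for d m n
    using rcos_factor[OF subs that(2,3)] that(1,4) by (simp add: g_def I_def)
  have rep: "\<exists>m\<in>M. \<exists>n\<in>N. f d = I #> (m \<otimes> n)" if d: "d \<in> carrier A" for d
  proof -
    obtain x where x: "x \<in> carrier G" "f d = I #> x"
      using tg_Hom_setD(1)[OF f(1) d] by (auto simp: rcosets_eq_image I_def)
    then have "x \<in> M <#> N"
      using rcos_self[OF x(1) Isub(1)] f(2)[OF d] by blast
    then show ?thesis
      using x(2) by (auto simp: set_mult_def)
  qed
  have "g \<in> tg_Hom_set A (tg_quot G I)"
  proof (rule tg_Hom_setI)
    fix d assume d: "d \<in> carrier A"
    then show "g d \<in> carrier (tg_quot G I)"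
      using rep[OF d] g[OF d] NG rcosetsI[OF Isub(2)] by auto
  next
    fix d d' assume d: "d \<in> carrier A" "d' \<in> carrier A"
    obtain m n m' n' where mn: "m \<in> M" "n \<in> N" "m' \<in> M" "n' \<in> N"
      and fd: "f d = I #> (m \<otimes> n)" "f d' = I #> (m' \<otimes> n')"
      using rep[OF d(1)] rep[OF d(2)] by blast
    have G: "m \<in> carrier G" "n \<in> carrier G" "m' \<in> carrier G" "n' \<in> carrier G"
      using mn MG NG by auto
    have "f (d \<otimes>\<^bsub>A\<^esub> d') = f d <#> f d'"
      using tg_Hom_setD(2)[OF f(1) d] by simp
    also have "\<dots> = I #> (m \<otimes> n \<otimes> (m' \<otimes> n'))"
      using G by (simp add: fd I.rcos_sum)
    \<comment> \<open>Moving \<open>m'\<close> to the left past \<open>n\<close> replaces it by a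
      conjugate, which stays in \<open>M\<close> by normality; the product is again an element of
      \<open>M\<close> times an element of \<open>N\<close>.\<close>
    also have "inv n \<otimes> (n \<otimes> n') = n'"
      using G by (simp add: m_assoc[symmetric])
    then have "m \<otimes> n \<otimes> (m' \<otimes> n') = (m \<otimes> (n \<otimes> m' \<otimes> inv n)) \<otimes> (n \<otimes> n')"
      using G by (simp add: m_assoc)
    finally have "f (d \<otimes>\<^bsub>A\<^esub> d') = I #> ((m \<otimes> (n \<otimes> m' \<otimes> inv n)) \<otimes> (n \<otimes> n'))" .
    moreover have "m \<otimes> (n \<otimes> m' \<otimes> inv n) \<in> M" "n \<otimes> n' \<in> N"
      using subs mn normal_invE(2)[OF M(1) G(2) mn(3)] by (auto simp: subgroup.m_closed)
    ultimately have "g (d \<otimes>\<^bsub>A\<^esub> d') = I #> (n \<otimes> n')"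
      using d by (intro g) auto
    also have "\<dots> = g d <#> g d'"
      using G g[OF d(1) mn(1,2) fd(1)] g[OF d(2) mn(3,4) fd(2)] by (simp add: I.rcos_sum)
    finally show "g (d \<otimes>\<^bsub>A\<^esub> d') = g d \<otimes>\<^bsub>tg_quot G I\<^esub> g d'"
      by simp
  next
    have "closedin (topol A) {d \<in> carrier A. g d \<in> S}" if S: "closedin (quot_topology G I) S" for S
    proof -
      define P where "P = N \<inter> {x \<in> carrier G. I #> x \<in> S}"
      define T where "T = (\<lambda>x. I #> x) ` (M <#> P)"
      have PG: "P \<subseteq> carrier G" by (auto simp: P_def)
      have MPG: "M <#> P \<subseteq> carrier G"
        using MG PG by (rule setmult_subset_G)
      have "closedin (topol G) P"
        using S N(2) by (auto simp: P_def closedin_quot_topology[OF Isub(2)])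
      then have "closedin (topol G) (M <#> P)"
        using M(2) closedin_set_mult by blast
      \<comment> \<open>Since \<open>I \<subseteq> M\<close>, the set \<open>M <#> P\<close> is a
        union of cosets of \<open>I\<close>, hence the full preimage of \<open>T\<close>.\<close>
      moreover have sat: "x \<in> M <#> P" if x: "x \<in> carrier G" "I #> x \<in> T" for x
      proof -
        obtain m p where mp: "m \<in> M" "p \<in> P" "I #> x = I #> (m \<otimes> p)"
          using x(2) by (auto simp: T_def set_mult_def)
        have "x \<in> I #> (m \<otimes> p)"
          using rcos_self[OF x(1) Isub(1)] mp(3) by simp
        then obtain i where "i \<in> I" "x = i \<otimes> (m \<otimes> p)"
          by (auto simp: r_coset_def)
        then have "x = (i \<otimes> m) \<otimes> p" "i \<otimes> m \<in> M"
          using mp MG PG Isub subs(1) by (auto simp: m_assoc subset_iff subgroup.m_closed)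
        then show ?thesis
          using mp(2) by (auto simp: set_mult_def)
      qed
      then have "{x \<in> carrier G. I #> x \<in> T} = M <#> P"
        using MPG by (auto simp: T_def)
      ultimately have "closedin (quot_topology G I) T"
        using MPG rcosetsI[OF Isub(2)] by (auto simp: closedin_quot_topology[OF Isub(2)] T_def)
      then have "closedin (topol A) {d \<in> carrier A. f d \<in> T}"
        using tg_Hom_setD(3)[OF f(1)] A(1) by (auto simp: continuous_map_closedin I_def)
      moreover have "g d \<in> S \<longleftrightarrow> f d \<in> T" if d: "d \<in> carrier A" for d
      proof -
        obtain m n where mn: "m \<in> M" "n \<in> N" "f d = I #> (m \<otimes> n)"
          using rep[OF d] by blast
        have gd: "g d = I #> n"
          using g[OF d mn] .
        show ?thesis
        proof
          assume "g d \<in> S"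
          then have "n \<in> P"
            using mn NG by (auto simp: P_def gd)
          then show "f d \<in> T"
            using mn by (auto simp: T_def set_mult_def)
        next
          assume "f d \<in> T"
          then obtain m' p where p: "m' \<in> M" "p \<in> P" "f d = I #> (m' \<otimes> p)"
            by (auto simp: T_def set_mult_def)
          \<comment> \<open>The value of \<open>g\<close> is independent of the factorization of the
            coset, so \<open>p\<close> may replace \<open>n\<close>.\<close>
          then have "g d = I #> p"
            using g[OF d p(1)] by (auto simp: P_def)
          then show "g d \<in> S"
            using p(2) by (auto simp: P_def)
        qed
      qed
      ultimately show ?thesis
        by (simp cong: conj_cong)
    qed
    moreover have "g d \<in> rcosets I" if d: "d \<in> carrier A" for d
      using rep[OF d] g[OF d] NG rcosetsI[OF Isub(2)] by auto
    ultimately show "continuous_map (topol A) (topol (tg_quot G I)) g"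
      using A(1) by (auto simp: continuous_map_closedin topspace_quot_topology[OF Isub(2)])
  qed (simp add: g_def)
  then show thesis
    using g unfolding I_def by (rule that)
qed

lemma (in compact_group) tg_Hom_split:
  assumes M: "M \<lhd> G" "closedin (topol G) M" and N: "N \<lhd> G" "closedin (topol G) N"
    and A: "topspace (topol A) = carrier A" "group A"
    and f: "f \<in> tg_Hom_set A (tg_quot G (M \<inter> N))" "\<And>d. d \<in> carrier A \<Longrightarrow> f d \<subseteq> M <#> N"
  obtains f1 f2 where "f1 \<in> tg_Hom_set A (tg_quot G (M \<inter> N))" "f2 \<in> tg_Hom_set A (tg_quot G (M \<inter> N))"
    and "\<And>d. d \<in> carrier A \<Longrightarrow> f1 d \<subseteq> M" "\<And>d. d \<in> carrier A \<Longrightarrow> f2 d \<subseteq> N"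
    and "f = f1 \<otimes>\<^bsub>tg_Hom A (tg_quot G (M \<inter> N))\<^esub> f2"
proof -
  note subs = normal_imp_subgroup[OF M(1)] normal_imp_subgroup[OF N(1)]
  note Isub = subgroups_Inter_pair[OF subs]
  interpret I: normal "M \<inter> N" G
    using M(1) N(1) by (rule normal_subgroup_intersect)
  have MG: "M \<subseteq> carrier G" and NG: "N \<subseteq> carrier G"
    using subs subgroup.subset by auto
  have com: "N <#> M = M <#> N"
    using M(1) subs by (simp add: commut_normal)
  have com': "N \<inter> M = M \<inter> N" by blast
  obtain f2 where f2: "f2 \<in> tg_Hom_set A (tg_quot G (M \<inter> N))"
    "\<And>d m n. \<lbrakk>d \<in> carrier A; m \<in> M; n \<in> N; f d = (M \<inter> N) #> (m \<otimes> n)\<rbrakk> \<Longrightarrow> f2 d = (M \<inter> N) #> n"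
    by (rule tg_Hom_project[OF M N A f]) (assumption, rule that)
  \<comment> \<open>The other component is the same projection with \<open>M\<close> and
    \<open>N\<close> exchanged, so it expects factorizations with the element of \<open>N\<close>
    first; \<open>commuting_rcos\<close> supplies them below.\<close>
  obtain f1 where f1: "f1 \<in> tg_Hom_set A (tg_quot G (M \<inter> N))"
    "\<And>d m n. \<lbrakk>d \<in> carrier A; n \<in> N; m \<in> M; f d = (M \<inter> N) #> (n \<otimes> m)\<rbrakk> \<Longrightarrow> f1 d = (M \<inter> N) #> m"
    by (rule tg_Hom_project[OF N M A, unfolded com com', OF f]) (assumption, rule that)
  have key: "f1 d \<subseteq> M \<and> f2 d \<subseteq> N \<and> f d = f1 d <#> f2 d" if d: "d \<in> carrier A" for d
  proof -
    obtain x where x: "x \<in> carrier G" "f d = (M \<inter> N) #> x"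
      using tg_Hom_setD(1)[OF f(1) d] by (auto simp: rcosets_eq_image)
    then have "x \<in> M <#> N"
      using rcos_self[OF x(1) Isub] f(2)[OF d] by blast
    then obtain m n where mn: "m \<in> M" "n \<in> N" "f d = (M \<inter> N) #> (m \<otimes> n)"
      using x(2) by (auto simp: set_mult_def)
    have G: "m \<in> carrier G" "n \<in> carrier G"
      using mn MG NG by auto
    have e: "f1 d = (M \<inter> N) #> m" "f2 d = (M \<inter> N) #> n"
      using f1(2)[OF d mn(2,1)] f2(2)[OF d mn] mn(3) commuting_rcos[OF M(1) N(1) mn(1,2)] by auto
    show ?thesis
      using G mn rcos_subset_iff[OF Isub subs(1)] rcos_subset_iff[OF Isub subs(2)]
      by (simp add: e I.rcos_sum)
  qed
  have "f = f1 \<otimes>\<^bsub>tg_Hom A (tg_quot G (M \<inter> N))\<^esub> f2"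
    using key tg_Hom_setD(4)[OF f(1)] by (auto simp: fun_eq_iff extensional_def)
  then show thesis
    using key by (intro that[OF f1(1) f2(1)]) simp_all
qed

text \<open>\<open>quot_induced\<close> extracts the element of the image of a coset, which is
  meaningful when that image is a singleton; invariance under left multiplication by
  \<open>N\<close> ensures this.\<close>

lemma (in group) quot_induced_rcos:
  assumes N: "subgroup N G" and x: "x \<in> carrier G" and g: "\<And>n. n \<in> N \<Longrightarrow> g (n \<otimes> x) = g x"
  shows "quot_induced g (N #> x) = g x"
proof -
  have "g ` (N #> x) = {g x}"
    using g rcos_self[OF x N] by (auto simp: r_coset_def)
  then show ?thesis
    by (simp add: quot_induced_def)
qed

lemma (in group) r_coset_absorb:
  assumes N: "subgroup N G" and n: "n \<in> N" and x: "x \<in> carrier G"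
  shows "N #> (n \<otimes> x) = N #> x"
  using assms subgroup.mem_carrier[OF N n] by (simp add: rcos_eq_iff[OF N] m_assoc)

lemma (in topological_group) subgroup_tg_quot:
  assumes N: "N \<lhd> G" and M: "subgroup M G"
  shows "subgroup ((\<lambda>x. N #> x) ` M) (tg_quot G N)"
proof -
  interpret normal N G by (rule N)
  have Q: "group (tg_quot G N)"
    using is_group N by (rule group_tg_quot)
  have MG: "M \<subseteq> carrier G"
    using M subgroup.subset by blast
  show ?thesis
  proof (rule group.subgroupI[OF Q])
    show "(\<lambda>x. N #> x) ` M \<subseteq> carrier (tg_quot G N)"
      using MG by (auto simp: rcosets_eq_image)
    show "(\<lambda>x. N #> x) ` M \<noteq> {}"
      using subgroup.one_closed[OF M] by blast
  next
    fix X assume "X \<in> (\<lambda>x. N #> x) ` M"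
    then obtain x where x: "x \<in> M" "X = N #> x" by blast
    then have xG: "x \<in> carrier G" using MG by blast
    have "inv\<^bsub>tg_quot G N\<^esub> X = N #> inv x"
      using xG x(2) subset by (intro group.inv_equality[OF Q]) (auto simp: rcos_sum rcosets_eq_image)
    then show "inv\<^bsub>tg_quot G N\<^esub> X \<in> (\<lambda>x. N #> x) ` M"
      using subgroup.m_inv_closed[OF M x(1)] by blast
  next
    fix X Y assume "X \<in> (\<lambda>x. N #> x) ` M" "Y \<in> (\<lambda>x. N #> x) ` M"
    then obtain x y where xy: "x \<in> M" "X = N #> x" "y \<in> M" "Y = N #> y" by blast
    then have "X \<otimes>\<^bsub>tg_quot G N\<^esub> Y = N #> (x \<otimes> y)"
      using MG by (simp add: rcos_sum subset_iff)
    then show "X \<otimes>\<^bsub>tg_quot G N\<^esub> Y \<in> (\<lambda>x. N #> x) ` M"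
      using subgroup.m_closed[OF M xy(1,3)] by blast
  qed
qed

subsection \<open>Coherent representations\<close>

lemma Act_flat [simp]: "Act (flat G E) g H = conj_set G g H"
  by (simp add: flat_def)

lemma Base_flat: "Base (flat G E) = fst ` Base E"
  by (simp add: flat_def)

lemma lift_functor_sel [simp]:
  "Obj (lift_functor C) x = Obj C (fst x)" "Ind (lift_functor C) x y = Ind C (fst x) (fst y)"
  "Con (lift_functor C) g x = Con C g (fst x)"
  by (simp_all add: lift_functor_def)

locale coherent_representation =
  fixes G :: "'g tgroup"
    and E :: "('g, 'g set \<times> 'g set) ric_domain"
    and R :: "'g set \<Rightarrow> 'g set"
    and D :: "('g, 'g set, 'd) ric_functor"
    and C :: "('g, 'g set, 'c) ric_functor"
    and \<Phi> :: "'g set \<times> 'g set \<Rightarrow> 'c set"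
    and \<theta> :: "'g set \<times> 'g set \<Rightarrow> ('d \<Rightarrow> 'g set) \<Rightarrow> 'c set"
  assumes G: "compact_group G"
    and datum: "classification_datum G E R D" and coherent: "L_coherent G E R D"
    and rep: "spectrum_representation G E C \<Phi>"
    and iso: "ric_iso G E (ric_Hom E (lift_functor D) (Pi_functor G R))
           (ric_quotient E (lift_functor C) \<Phi>) \<theta>"
begin

lemma sys2: "subgroup_system2 G E"
  using datum by (auto simp: classification_datum_def spectrum_def)

lemma dom: "ric_domain G E"
  using sys2 by (auto simp: subgroup_system2_def)

lemma DInd_refl: "x \<in> Base E \<Longrightarrow> x \<in> DInd E x"
  using dom by (auto simp: ric_domain_def ric_family_def)

lemma Act_Base:
  assumes "(H, U) \<in> Base E" "g \<in> carrier G"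
  shows "Act E g (H, U) = (conj_set G g H, conj_set G g U)"
  using sys2 assms by (auto simp: subgroup_system2_def)

text \<open>On \<open>Base E\<close> conjugation of pairs is the group action of the RIC-domain, so
  closure and inversion are read off from the action laws.\<close>

lemma conj_inverse:
  assumes HU: "(H, U) \<in> Base E" and g: "g \<in> carrier G"
  shows "(conj_set G g H, conj_set G g U) \<in> Base E"
    and "conj_set G (inv\<^bsub>G\<^esub> g) (conj_set G g H) = H"
    and "conj_set G (inv\<^bsub>G\<^esub> g) (conj_set G g U) = U"
proof -
  interpret compact_group G by (rule G)
  interpret act: group_action G "Base E" "\<lambda>g. restrict (Act E g) (Base E)"
    using dom by (auto simp: ric_domain_def)
  have e: "restrict (Act E g) (Base E) (H, U) = (conj_set G g H, conj_set G g U)"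
    using HU g by (simp add: Act_Base)
  show B: "(conj_set G g H, conj_set G g U) \<in> Base E"
    using act.element_image[OF g HU e] .
  have "restrict (Act E (inv\<^bsub>G\<^esub> g)) (Base E) (conj_set G g H, conj_set G g U) = (H, U)"
    using act.orbit_sym_aux[OF g HU e] .
  then show "conj_set G (inv\<^bsub>G\<^esub> g) (conj_set G g H) = H" "conj_set G (inv\<^bsub>G\<^esub> g) (conj_set G g U) = U"
    using B g by (simp_all add: Act_Base)
qed

lemma C_functor: "ric_functor G (flat G E) C" and \<Phi>_sub: "ric_subfunctor G E (lift_functor C) \<Phi>"
  using rep by (auto simp: spectrum_representation_def)

lemma \<Phi>_subD:
  assumes "x \<in> Base E"
  shows "subgroup (\<Phi> x) (Obj C (fst x))"
    and "y \<in> DInd E x \<Longrightarrow> Ind C (fst x) (fst y) ` \<Phi> y \<subseteq> \<Phi> x"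
    and "g \<in> carrier G \<Longrightarrow> Con C g (fst x) ` \<Phi> x \<subseteq> \<Phi> (Act E g x)"
  using bspec[OF \<Phi>_sub[unfolded ric_subfunctor_def lift_functor_sel] assms] by blast+

text \<open>Stability of the subfunctor under \<open>Con\<close> gives one inclusion; stability for
  \<open>inv g\<close> at the conjugate pair gives the other.\<close>

lemma \<Phi>_con_image:
  assumes HU: "(H, U) \<in> Base E" and g: "g \<in> carrier G"
  shows "Con C g H ` \<Phi> (H, U) = \<Phi> (conj_set G g H, conj_set G g U)"
proof -
  interpret compact_group G by (rule G)
  note inv = conj_inverse[OF HU g]
  have sub: "Con C k K ` \<Phi> (K, V) \<subseteq> \<Phi> (conj_set G k K, conj_set G k V)"
    if "(K, V) \<in> Base E" "k \<in> carrier G" for k K V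
    using \<Phi>_subD(3)[OF that] Act_Base[OF that] by simp
  have "b \<in> Con C g H ` \<Phi> (H, U)" if b: "b \<in> \<Phi> (conj_set G g H, conj_set G g U)" for b
  proof -
    let ?a = "Con C (inv\<^bsub>G\<^esub> g) (conj_set G g H) b"
    have bC: "b \<in> carrier (Obj C (conj_set G g H))"
      using subgroup.mem_carrier[OF \<Phi>_subD(1)[OF inv(1)] b] by simp
    have K: "conj_set G g H \<in> Base (flat G E)"
      using inv(1) by (auto simp: Base_flat intro: rev_image_eqI)
    have "?a \<in> \<Phi> (H, U)"
      using sub[OF inv(1), of "inv\<^bsub>G\<^esub> g"] g b inv(2,3) by auto
    moreover have "Con C g H ?a = Con C (g \<otimes>\<^bsub>G\<^esub> inv\<^bsub>G\<^esub> g) (conj_set G g H) b"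
      using ric_functor.con_comp[OF C_functor K _ g bC, of "inv\<^bsub>G\<^esub> g"] g inv(2) by simp
    then have "Con C g H ?a = b"
      using ric_functor.con_id[OF C_functor K bC] g by simp
    ultimately show ?thesis
      by (metis imageI)
  qed
  then show ?thesis
    using sub[OF HU g] by blast
qed

end

section \<open>Both functors at a fixed first component \<open>H\<close>\<close>

locale coherent_representation_at = coherent_representation +
  fixes H :: "'a set"
  assumes H: "H \<in> Base (flat G E)"
begin

abbreviation UR where "UR U \<equiv> U <#>\<^bsub>G\<^esub> R H"

sublocale G: compact_group G by (rule G)

lemma ab: "closed_subgroup H G" "closed_subgroup (R H) G" "R H \<lhd> tg_sub G H"
  using datum H by (auto simp: classification_datum_def abelianization_system_def)

sublocale S: compact_group "tg_sub G H"
  using G.compact_group_tg_sub ab(1) by blast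

lemma Ext_iff: "U \<in> Ext E H \<longleftrightarrow> (H, U) \<in> Base E"
  by (simp add: Ext_def)

lemma closedin_S_iff: "closedin (topol (tg_sub G H)) X \<longleftrightarrow> closedin (topol G) X \<and> X \<subseteq> H"
  using ab(1) by (simp add: closed_subgroup_def closedin_closed_subtopology)

lemma Ext_normal:
  assumes "U \<in> Ext E H"
  shows "U \<lhd> tg_sub G H" "closedin (topol (tg_sub G H)) U"
proof -
  have "(H, U) \<in> Grp2 G"
    using sys2 assms by (auto simp: Ext_iff subgroup_system2_def)
  then show n: "U \<lhd> tg_sub G H" and "closedin (topol (tg_sub G H)) U"
    using subgroup.subset[OF normal_imp_subgroup, of U "tg_sub G H"]
    by (auto simp: Grp2_def closedin_S_iff closed_subgroup_def simp del: tg_sub_sel(4))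
qed

lemma R_closed: "closedin (topol (tg_sub G H)) (R H)"
  using ab subgroup.subset[OF normal_imp_subgroup[OF ab(3)]]
  by (auto simp: closedin_S_iff closed_subgroup_def simp del: tg_sub_sel(4))

text \<open>\<open>UR U\<close> is the subgroup divided out in \<open>Pi_functor\<close>. It is
  closed because products of closed sets are closed in the compact group
  \<open>tg_sub G H\<close>.\<close>

lemma UR:
  assumes "U \<in> Ext E H"
  shows "UR U \<lhd> tg_sub G H" "subgroup (UR U) (tg_sub G H)" "closedin (topol (tg_sub G H)) (UR U)"
    "closed_subgroup (UR U) (tg_sub G H)"
proof -
  show n: "UR U \<lhd> tg_sub G H"
    using S.normal_set_mult[OF Ext_normal(1)[OF assms] ab(3)] by simp
  then show s: "subgroup (UR U) (tg_sub G H)"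
    by (rule normal_imp_subgroup)
  show c: "closedin (topol (tg_sub G H)) (UR U)"
    using S.closedin_set_mult[OF Ext_normal(2)[OF assms] R_closed] by simp
  show "closed_subgroup (UR U) (tg_sub G H)"
    using s c by (simp add: closed_subgroup_def)
qed

lemma UR_absorb:
  assumes "U \<in> Ext_R E R H"
  shows "UR U = U"
  using S.set_mult_absorb[OF normal_imp_subgroup[OF Ext_normal(1)] normal_imp_subgroup[OF ab(3)]] assms
  by (simp add: Ext_R_def)

lemma UR_UR:
  assumes "U \<in> Ext E H"
  shows "UR (UR U) = UR U"
  using S.set_mult_absorb[OF UR(2)[OF assms] normal_imp_subgroup[OF ab(3)]]
    S.subset_set_mult(2)[OF normal_imp_subgroup[OF Ext_normal(1)[OF assms]] normal_imp_subgroup[OF ab(3)]]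
  by simp

lemma UR_mono: "U \<subseteq> V \<Longrightarrow> UR U \<subseteq> UR V"
  by (auto simp: set_mult_def)

abbreviation A where "A \<equiv> Obj D H"
abbreviation B where "B \<equiv> Obj C H"
abbreviation Q where "Q U \<equiv> tg_quot (tg_sub G H) (UR U)"

lemma D_functor: "ric_functor G (flat G E) D"
  using datum by (auto simp: classification_datum_def dualizing_functor_def)

sublocale A: topological_group A
  using ric_functor.obj[OF D_functor H] by (simp add: topological_abelian_group_def)

sublocale B: topological_group B
  using ric_functor.obj[OF C_functor H] by (simp add: topological_abelian_group_def)

sublocale B: comm_group B
  using ric_functor.obj[OF C_functor H] by (simp add: topological_abelian_group_def)

lemma Q_group: "U \<in> Ext E H \<Longrightarrow> group (Q U)"
  using group_tg_quot[OF S.is_group UR(1)] .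

lemma Q_topspace: "U \<in> Ext E H \<Longrightarrow> topspace (topol (Q U)) = carrier (Q U)"
  using S.topspace_quot_topology[OF subgroup.subset[OF UR(2)]] by simp

lemma \<Phi>_subgroup:
  assumes "U \<in> Ext E H"
  shows "subgroup (\<Phi> (H, U)) B"
  using \<Phi>_subD(1)[of "(H, U)"] assms by (simp add: Ext_iff)

lemma \<Phi>_normal:
  assumes "U \<in> Ext E H"
  shows "\<Phi> (H, U) \<lhd> B"
  using \<Phi>_subgroup[OF assms] by (simp add: B.normal_iff_subgroup)

text \<open>On first components this induction is \<open>Ind C H H\<close>, the identity, so
  stability under induction is an inclusion.\<close>

lemma \<Phi>_mono:
  assumes "U1 \<in> Ext E H" "(H, U2) \<in> DInd E (H, U1)" "U2 \<in> Ext E H"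
  shows "\<Phi> (H, U2) \<subseteq> \<Phi> (H, U1)"
proof -
  have "Ind C H H ` \<Phi> (H, U2) \<subseteq> \<Phi> (H, U1)"
    using \<Phi>_subD(2)[OF _ assms(2)] assms(1) by (simp add: Ext_iff)
  moreover have "Ind C H H c = c" if "c \<in> \<Phi> (H, U2)" for c
    using ric_functor.ind_id[OF C_functor H] subgroup.mem_carrier[OF \<Phi>_subgroup[OF assms(3)] that] .
  ultimately show ?thesis by force
qed

abbreviation W where "W U \<equiv> tg_Hom A (Q U)"
abbreviation Z where "Z U \<equiv> tg_quot B (\<Phi> (H, U))"

lemma one_closed: "U \<in> Ext E H \<Longrightarrow> \<one>\<^bsub>W U\<^esub> \<in> tg_Hom_set A (Q U)"
  using tg_Hom_one_closed[OF A.topspace_topol A.is_group Q_group Q_topspace] by simp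

lemma Obj_simps:
  "Obj (ric_Hom E (lift_functor D) (Pi_functor G R)) (H, U) = W U"
  "Obj (ric_quotient E (lift_functor C) \<Phi>) (H, U) = Z U"
  by (simp_all add: ric_Hom_def ric_quotient_def Pi_functor_def)

lemma \<theta>_hom: "U \<in> Ext E H \<Longrightarrow> \<theta> (H, U) \<in> tg_hom (W U) (Z U)"
  using iso ric_morphism.hom[where x="(H, U)" and D=E] unfolding ric_iso_def Ext_iff Obj_simps[symmetric] by blast

lemma \<theta>_closed: "\<lbrakk>U \<in> Ext E H; f \<in> tg_Hom_set A (Q U)\<rbrakk> \<Longrightarrow> \<theta> (H, U) f \<in> carrier (Z U)"
  using \<theta>_hom[of U] by (auto simp: tg_hom_def hom_def)

text \<open>A single \<open>\<psi>\<close> serves all \<open>U\<close> at once and is a morphism of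
  functors, because \<open>\<theta>_ind\<close> needs its compatibility with induction between two
  different \<open>U\<close>.\<close>

lemma \<theta>_inverse:
  obtains \<psi> where "ric_morphism G E (ric_quotient E (lift_functor C) \<Phi>)
      (ric_Hom E (lift_functor D) (Pi_functor G R)) \<psi>"
    and "\<And>U. U \<in> Ext E H \<Longrightarrow> \<psi> (H, U) \<in> tg_hom (Z U) (W U)"
    and "\<And>U f. \<lbrakk>U \<in> Ext E H; f \<in> tg_Hom_set A (Q U)\<rbrakk> \<Longrightarrow> \<psi> (H, U) (\<theta> (H, U) f) = f"
    and "\<And>U c. \<lbrakk>U \<in> Ext E H; c \<in> carrier (Z U)\<rbrakk> \<Longrightarrow> \<theta> (H, U) (\<psi> (H, U) c) = c"
proof -
  obtain \<psi> where \<psi>: "ric_morphism G E (ric_quotient E (lift_functor C) \<Phi>)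
      (ric_Hom E (lift_functor D) (Pi_functor G R)) \<psi>"
    and inv: "\<forall>x\<in>Base E. (\<forall>a\<in>carrier (Obj (ric_Hom E (lift_functor D) (Pi_functor G R)) x). \<psi> x (\<theta> x a) = a) \<and>
      (\<forall>b\<in>carrier (Obj (ric_quotient E (lift_functor C) \<Phi>) x). \<theta> x (\<psi> x b) = b)"
    using iso unfolding ric_iso_def by blast
  show thesis
  proof (rule that[OF \<psi>])
    fix U assume U: "U \<in> Ext E H"
    show "\<psi> (H, U) \<in> tg_hom (Z U) (W U)"
      using ric_morphism.hom[OF \<psi>, of "(H, U)"] U by (simp only: Obj_simps Ext_iff)
    show "\<psi> (H, U) (\<theta> (H, U) f) = f" if "f \<in> tg_Hom_set A (Q U)" for f
      using bspec[OF inv, of "(H, U)"] U that by (simp only: Obj_simps Ext_iff tg_Hom_sel)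
    show "\<theta> (H, U) (\<psi> (H, U) c) = c" if "c \<in> carrier (Z U)" for c
      using bspec[OF inv, of "(H, U)"] U that by (simp only: Obj_simps Ext_iff)
  qed
qed

lemma \<theta>_inj:
  assumes "U \<in> Ext E H" "f \<in> tg_Hom_set A (Q U)" "g \<in> tg_Hom_set A (Q U)" "\<theta> (H, U) f = \<theta> (H, U) g"
  shows "f = g"
proof (rule \<theta>_inverse)
  fix \<psi> assume "\<And>U f. \<lbrakk>U \<in> Ext E H; f \<in> tg_Hom_set A (Q U)\<rbrakk> \<Longrightarrow> \<psi> (H, U) (\<theta> (H, U) f) = f"
  then show ?thesis using assms by metis
qed

lemma \<theta>_surj:
  assumes U: "U \<in> Ext E H" and c: "c \<in> carrier B"
  obtains f where "f \<in> tg_Hom_set A (Q U)" "\<theta> (H, U) f = \<Phi> (H, U) #>\<^bsub>B\<^esub> c"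
proof (rule \<theta>_inverse)
  fix \<psi> assume hom: "\<And>U. U \<in> Ext E H \<Longrightarrow> \<psi> (H, U) \<in> tg_hom (Z U) (W U)"
    and inv: "\<And>U c. \<lbrakk>U \<in> Ext E H; c \<in> carrier (Z U)\<rbrakk> \<Longrightarrow> \<theta> (H, U) (\<psi> (H, U) c) = c"
  have Z: "\<Phi> (H, U) #>\<^bsub>B\<^esub> c \<in> carrier (Z U)"
    using c by (auto simp: rcosets_eq_image)
  have "\<psi> (H, U) (\<Phi> (H, U) #>\<^bsub>B\<^esub> c) \<in> tg_Hom_set A (Q U)"
    using hom[OF U] Z unfolding tg_hom_def hom_def by auto
  then show thesis
    using inv[OF U Z] by (rule that)
qed

lemma \<theta>_rep:
  assumes "U \<in> Ext E H" "f \<in> tg_Hom_set A (Q U)"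
  obtains c where "c \<in> carrier B" "\<theta> (H, U) f = \<Phi> (H, U) #>\<^bsub>B\<^esub> c"
  using \<theta>_closed[OF assms] by (auto simp: rcosets_eq_image)

lemma \<theta>_mult:
  assumes "U \<in> Ext E H" "f \<in> tg_Hom_set A (Q U)" "g \<in> tg_Hom_set A (Q U)"
  shows "\<theta> (H, U) (f \<otimes>\<^bsub>W U\<^esub> g) = \<theta> (H, U) f <#>\<^bsub>B\<^esub> \<theta> (H, U) g"
  using \<theta>_hom[OF assms(1)] assms(2-) by (simp add: tg_hom_def hom_def)

text \<open>The trivial homomorphism squares to itself, so its image is an idempotent of the group
  \<open>Z U\<close>, hence the unit.\<close>

lemma \<theta>_one:
  assumes U: "U \<in> Ext E H"
  shows "\<theta> (H, U) \<one>\<^bsub>W U\<^esub> = \<Phi> (H, U)"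
proof -
  interpret Q: group "Q U"
    using U by (rule Q_group)
  interpret Z: group "Z U"
    using group_tg_quot[OF B.is_group \<Phi>_normal[OF U]] .
  have "\<one>\<^bsub>W U\<^esub> \<otimes>\<^bsub>W U\<^esub> \<one>\<^bsub>W U\<^esub> = \<one>\<^bsub>W U\<^esub>"
    using Q.l_one[OF Q.one_closed] by (auto simp: tg_Hom_one fun_eq_iff simp del: tg_quot_sel)
  then have "\<theta> (H, U) \<one>\<^bsub>W U\<^esub> \<otimes>\<^bsub>Z U\<^esub> \<theta> (H, U) \<one>\<^bsub>W U\<^esub> = \<theta> (H, U) \<one>\<^bsub>W U\<^esub>"
    using \<theta>_mult[OF U one_closed[OF U] one_closed[OF U]] by simp
  then show ?thesis
    using \<theta>_closed[OF U one_closed[OF U]] Z.l_cancel_one' by (metis tg_quot_sel(3))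
qed

text \<open>The structure map \<open>ind\<close> from \<open>(H, U2)\<close> to \<open>(H, U1)\<close> on the side of \<open>Hom(D, \<Pi>)\<close> is
  composition with the projection, on the side of \<open>C / \<Phi>\<close> it is the projection itself.\<close>

text \<open>The inverse of \<open>\<theta>\<close> is used instead of \<open>\<theta>\<close>: this way the image of \<open>f\<close> under \<open>ind\<close> is known to be a
  continuous homomorphism without checking that \<open>Hom(D, \<Pi>)\<close> is a functor.\<close>

lemma \<theta>_ind:
  assumes U: "U1 \<in> Ext E H" "U2 \<in> Ext E H" "U2 \<subseteq> U1" "(H, U2) \<in> DInd E (H, U1)"
    and f: "f \<in> tg_Hom_set A (Q U2)" and c: "c \<in> carrier B" "\<theta> (H, U2) f = \<Phi> (H, U2) #>\<^bsub>B\<^esub> c"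
  obtains f' where "f' \<in> tg_Hom_set A (Q U1)" "\<theta> (H, U1) f' = \<Phi> (H, U1) #>\<^bsub>B\<^esub> c"
    "\<And>d x. \<lbrakk>d \<in> carrier A; x \<in> H; f d = UR U2 #>\<^bsub>G\<^esub> x\<rbrakk> \<Longrightarrow> f' d = UR U1 #>\<^bsub>G\<^esub> x"
proof (rule \<theta>_inverse)
  let ?W = "ric_Hom E (lift_functor D) (Pi_functor G R)" and ?Z = "ric_quotient E (lift_functor C) \<Phi>"
  fix \<psi> assume mor: "ric_morphism G E ?Z ?W \<psi>"
    and hom: "\<And>U. U \<in> Ext E H \<Longrightarrow> \<psi> (H, U) \<in> tg_hom (Z U) (W U)"
    and inv1: "\<And>U f. \<lbrakk>U \<in> Ext E H; f \<in> tg_Hom_set A (Q U)\<rbrakk> \<Longrightarrow> \<psi> (H, U) (\<theta> (H, U) f) = f"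
    and inv2: "\<And>U c. \<lbrakk>U \<in> Ext E H; c \<in> carrier (Z U)\<rbrakk> \<Longrightarrow> \<theta> (H, U) (\<psi> (H, U) c) = c"
  define f' where "f' = \<psi> (H, U1) (\<Phi> (H, U1) #>\<^bsub>B\<^esub> c)"
  have Z1: "\<Phi> (H, U1) #>\<^bsub>B\<^esub> c \<in> carrier (Z U1)" and Z2: "\<Phi> (H, U2) #>\<^bsub>B\<^esub> c \<in> carrier (Z U2)"
    using c by (auto simp: rcosets_eq_image)
  have f'_hom: "f' \<in> tg_Hom_set A (Q U1)"
    using hom[OF U(1)] Z1 unfolding f'_def tg_hom_def hom_def by auto
  have f'_val: "\<theta> (H, U1) f' = \<Phi> (H, U1) #>\<^bsub>B\<^esub> c"
    unfolding f'_def using inv2[OF U(1) Z1] .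
  have indC: "Ind C H H a = a" if "a \<in> carrier B" for a
    using ric_functor.ind_id[OF C_functor H that] .
  \<comment> \<open>The induced map is well defined on cosets because
    \<open>\<Phi> (H, U2) \<subseteq> \<Phi> (H, U1)\<close>.\<close>
  have "Ind ?Z (H, U1) (H, U2) (\<Phi> (H, U2) #>\<^bsub>B\<^esub> c) = \<Phi> (H, U1) #>\<^bsub>B\<^esub> Ind C H H c"
    unfolding ric_quotient_def ric_functor.simps lift_functor_sel fst_conv
  proof (rule B.quot_induced_rcos[OF \<Phi>_subgroup[OF U(2)] c(1)])
    fix n assume n: "n \<in> \<Phi> (H, U2)"
    have nB: "n \<in> carrier B" and n1: "n \<in> \<Phi> (H, U1)"
      using subgroup.mem_carrier[OF \<Phi>_subgroup[OF U(2)] n] \<Phi>_mono[OF U(1,4,2)] n by auto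
    show "\<Phi> (H, U1) #>\<^bsub>B\<^esub> Ind C H H (n \<otimes>\<^bsub>B\<^esub> c) = \<Phi> (H, U1) #>\<^bsub>B\<^esub> Ind C H H c"
      using B.r_coset_absorb[OF \<Phi>_subgroup[OF U(1)] n1 c(1)] nB c(1) by (simp add: indC)
  qed
  then have Z: "Ind ?Z (H, U1) (H, U2) (\<theta> (H, U2) f) = \<Phi> (H, U1) #>\<^bsub>B\<^esub> c"
    using c by (simp add: indC)
  have "\<psi> (H, U1) (Ind ?Z (H, U1) (H, U2) (\<theta> (H, U2) f)) = Ind ?W (H, U1) (H, U2) (\<psi> (H, U2) (\<theta> (H, U2) f))"
    using U(1,4) Z2 c(2) by (intro ric_morphism.ind[OF mor]) (simp_all only: Ext_iff Obj_simps)
  then have f': "f' = Ind ?W (H, U1) (H, U2) f"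
    unfolding Z inv1[OF U(2) f] f'_def .
  \<comment> \<open>In \<open>ric_Hom\<close> the argument passes through the inverse of an
    induction map of \<open>D\<close>; from \<open>H\<close> to \<open>H\<close> that map is the
    identity.\<close>
  have inv: "inv_into (carrier A) (Ind D H H) d = d" if "d \<in> carrier A" for d
    using that ric_functor.ind_id[OF D_functor H] by (intro inv_into_f_eq) (auto simp: inj_on_def)
  have "f' d = UR U1 #>\<^bsub>G\<^esub> x" if d: "d \<in> carrier A" "x \<in> H" "f d = UR U2 #>\<^bsub>G\<^esub> x" for d x
  proof -
    have "quot_induced (\<lambda>h. UR U1 #>\<^bsub>G\<^esub> h) (UR U2 #>\<^bsub>tg_sub G H\<^esub> x) = UR U1 #>\<^bsub>G\<^esub> x"
    proof (rule S.quot_induced_rcos[OF UR(2)[OF U(2)]])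
      show "x \<in> carrier (tg_sub G H)" using d(2) by simp
      fix n assume "n \<in> UR U2"
      then have "n \<in> UR U1" using UR_mono[OF U(3)] by blast
      then show "UR U1 #>\<^bsub>G\<^esub> (n \<otimes>\<^bsub>tg_sub G H\<^esub> x) = UR U1 #>\<^bsub>G\<^esub> x"
        using S.r_coset_absorb[OF UR(2)[OF U(1)], of n x] d(2) by simp
    qed
    then show ?thesis
      using d by (simp add: f' ric_Hom_def Pi_functor_def inv)
  qed
  with f'_hom f'_val show thesis by (rule that)
qed

text \<open>Both sides say \<open>x \<in> UR U1\<close>: the kernel of the projection from
  \<open>Q U2\<close> to \<open>Q U1\<close> consists of the cosets contained in
  \<open>UR U1\<close>.\<close>

lemma Q_mem_iff:
  assumes U: "U1 \<in> Ext E H" "U2 \<in> Ext E H" "U2 \<subseteq> U1" and x: "x \<in> H"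
  shows "UR U1 #>\<^bsub>G\<^esub> x = UR U1 \<longleftrightarrow> UR U2 #>\<^bsub>G\<^esub> x \<subseteq> UR U1"
  using S.rcos_eq_self_iff[OF UR(2)[OF U(1)], of x] x
    S.rcos_subset_iff[OF UR(2)[OF U(2)] UR(2)[OF U(1)] UR_mono[OF U(3)], of x] by simp

text \<open>Injectivity of \<open>\<theta>\<close> at \<open>U1\<close> turns triviality of the
  coset of \<open>c\<close> into triviality of the projected homomorphism \<open>f'\<close>, which
  is then tested pointwise.\<close>

lemma mem_\<Phi>_iff:
  assumes U: "U1 \<in> Ext E H" "U2 \<in> Ext E H" "U2 \<subseteq> U1" "(H, U2) \<in> DInd E (H, U1)"
    and f: "f \<in> tg_Hom_set A (Q U2)" and c: "c \<in> carrier B" "\<theta> (H, U2) f = \<Phi> (H, U2) #>\<^bsub>B\<^esub> c"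
  shows "c \<in> \<Phi> (H, U1) \<longleftrightarrow> (\<forall>d\<in>carrier A. f d \<subseteq> UR U1)"
proof -
  obtain f' where f': "f' \<in> tg_Hom_set A (Q U1)" "\<theta> (H, U1) f' = \<Phi> (H, U1) #>\<^bsub>B\<^esub> c"
    and val: "\<And>d x. \<lbrakk>d \<in> carrier A; x \<in> H; f d = UR U2 #>\<^bsub>G\<^esub> x\<rbrakk> \<Longrightarrow> f' d = UR U1 #>\<^bsub>G\<^esub> x"
    by (rule \<theta>_ind[OF assms]) (rule that)
  have "c \<in> \<Phi> (H, U1) \<longleftrightarrow> \<theta> (H, U1) f' = \<theta> (H, U1) \<one>\<^bsub>W U1\<^esub>"
    unfolding f'(2) \<theta>_one[OF U(1)] using B.rcos_eq_self_iff[OF \<Phi>_subgroup[OF U(1)] c(1)] by simp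
  also have "\<dots> \<longleftrightarrow> f' = \<one>\<^bsub>W U1\<^esub>"
    using \<theta>_inj[OF U(1) f'(1) one_closed[OF U(1)]] by blast
  also have "\<dots> \<longleftrightarrow> (\<forall>d\<in>carrier A. f' d = UR U1)"
    using tg_Hom_one_eqI[OF f'(1)] by (auto simp: tg_Hom_one)
  also have "\<dots> \<longleftrightarrow> (\<forall>d\<in>carrier A. f d \<subseteq> UR U1)"
  proof (intro ball_cong refl)
    fix d assume d: "d \<in> carrier A"
    obtain x where x: "x \<in> H" "f d = UR U2 #>\<^bsub>G\<^esub> x"
      using tg_Hom_setD(1)[OF f d] by (auto simp: rcosets_eq_image)
    show "f' d = UR U1 \<longleftrightarrow> f d \<subseteq> UR U1"
      using Q_mem_iff[OF U(1-3) x(1)] by (simp add: x(2) val[OF d x])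
  qed
  finally show ?thesis .
qed

end

section \<open>The individual assertions of the theorem\<close>

context coherent_representation_at
begin

lemma Ext_R_D:
  assumes "U \<in> Ext_R E R H"
  shows "U \<in> Ext E H" "R H \<subseteq> U" "UR U = U"
  using assms UR_absorb by (auto simp: Ext_R_def)

lemma Ext_R_DInd:
  assumes "U1 \<in> Ext_R E R H" "U2 \<in> Ext_R E R H" "U2 \<subseteq> U1"
  shows "(H, U2) \<in> DInd E (H, U1)"
  using coherent assms H by (auto simp: L_coherent_def)

text \<open>The inverse of \<open>\<theta>\<close> is continuous and sends only the trivial coset to
  the trivial homomorphism, so a closed or open unit of \<open>W U\<close> pulls back to a closed or
  open unit of \<open>Z U\<close>.\<close>

lemma inverse_preimage:
  assumes U: "U \<in> Ext E H"
  obtains \<psi> where "continuous_map (topol (Z U)) (topol (W U)) \<psi>"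
    "{z \<in> topspace (topol (Z U)). \<psi> z \<in> {\<one>\<^bsub>W U\<^esub>}} = {\<Phi> (H, U)}"
proof (rule \<theta>_inverse)
  fix \<psi> assume hom: "\<And>U. U \<in> Ext E H \<Longrightarrow> \<psi> (H, U) \<in> tg_hom (Z U) (W U)"
    and inv1: "\<And>U f. \<lbrakk>U \<in> Ext E H; f \<in> tg_Hom_set A (Q U)\<rbrakk> \<Longrightarrow> \<psi> (H, U) (\<theta> (H, U) f) = f"
    and inv2: "\<And>U c. \<lbrakk>U \<in> Ext E H; c \<in> carrier (Z U)\<rbrakk> \<Longrightarrow> \<theta> (H, U) (\<psi> (H, U) c) = c"
  have top: "topspace (topol (Z U)) = carrier (Z U)"
    using B.topspace_quot_topology[OF subgroup.subset[OF \<Phi>_subgroup[OF U]]] by simp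
  have one: "\<Phi> (H, U) \<in> carrier (Z U)" "\<psi> (H, U) (\<Phi> (H, U)) = \<one>\<^bsub>W U\<^esub>"
    using \<theta>_closed[OF U one_closed[OF U]] inv1[OF U one_closed[OF U]] unfolding \<theta>_one[OF U] .
  have "z = \<Phi> (H, U)" if "z \<in> carrier (Z U)" "\<psi> (H, U) z = \<one>\<^bsub>W U\<^esub>" for z
    using inv2[OF U that(1)] unfolding that(2) \<theta>_one[OF U] by simp
  then have "{z \<in> topspace (topol (Z U)). \<psi> (H, U) z \<in> {\<one>\<^bsub>W U\<^esub>}} = {\<Phi> (H, U)}"
    using one unfolding top by blast
  moreover have "continuous_map (topol (Z U)) (topol (W U)) (\<psi> (H, U))"
    using hom[OF U] by (simp add: tg_hom_def)
  ultimately show thesis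
    using that by blast
qed

lemma \<Phi>_closed:
  assumes U: "U \<in> Ext E H"
  shows "closedin (topol B) (\<Phi> (H, U))"
proof (rule inverse_preimage[OF U])
  fix \<psi> assume \<psi>: "continuous_map (topol (Z U)) (topol (W U)) \<psi>"
    "{z \<in> topspace (topol (Z U)). \<psi> z \<in> {\<one>\<^bsub>W U\<^esub>}} = {\<Phi> (H, U)}"
  have "closedin (topol (Q U)) {\<one>\<^bsub>Q U\<^esub>}"
    using UR(3)[OF U] S.closed_one_quot_iff[OF UR(2)[OF U]] by simp
  then have "closedin (topol (W U)) {\<one>\<^bsub>W U\<^esub>}"
    by (rule closedin_tg_Hom_one[OF A.topspace_topol A.is_group Q_group[OF U] Q_topspace[OF U]])
  from closedin_continuous_map_preimage[OF \<psi>(1) this] show ?thesis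
    unfolding \<psi>(2) using B.closed_one_quot_iff[OF \<Phi>_subgroup[OF U]] by simp
qed

text \<open>Openness passes from \<open>UR U\<close> to the units of \<open>Q U\<close>,
  \<open>W U\<close> and \<open>Z U\<close> in turn. The two kinds of \<open>D\<close> enter through
  the choice of \<open>K\<close>: all of \<open>A\<close> when \<open>A\<close> is compact, one
  generator when \<open>A\<close> is a copy of the integers.\<close>

lemma \<Phi>_open:
  assumes U: "U \<in> Ext E H" and "openin (topol (tg_sub G H)) U" and K: "compactin (topol A) K"
    and gen: "\<And>f. \<lbrakk>f \<in> tg_Hom_set A (Q U); \<forall>d\<in>K. f d = \<one>\<^bsub>Q U\<^esub>\<rbrakk> \<Longrightarrow> \<forall>d\<in>carrier A. f d = \<one>\<^bsub>Q U\<^esub>"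
  shows "openin (topol B) (\<Phi> (H, U))"
proof (rule inverse_preimage[OF U])
  fix \<psi> assume \<psi>: "continuous_map (topol (Z U)) (topol (W U)) \<psi>"
    "{z \<in> topspace (topol (Z U)). \<psi> z \<in> {\<one>\<^bsub>W U\<^esub>}} = {\<Phi> (H, U)}"
  have "openin (topol (tg_sub G H)) (UR U)"
    using S.openin_set_mult[OF assms(2) subgroup.subset[OF normal_imp_subgroup[OF ab(3)]]] by simp
  then have "openin (topol (Q U)) {\<one>\<^bsub>Q U\<^esub>}"
    using S.open_one_quot_iff[OF UR(2)[OF U]] by simp
  from openin_tg_Hom_one[OF A.topspace_topol A.is_group Q_group[OF U] Q_topspace[OF U] this K gen]
  have "openin (topol (W U)) {\<one>\<^bsub>W U\<^esub>}" .
  from openin_continuous_map_preimage[OF \<psi>(1) this] show ?thesis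
    unfolding \<psi>(2) using B.open_one_quot_iff[OF \<Phi>_subgroup[OF U]] by simp
qed

lemma \<Phi>_open_compact:
  assumes "U \<in> Ext E H" "openin (topol (tg_sub G H)) U" "compact_space (topol A)"
  shows "openin (topol B) (\<Phi> (H, U))"
  using assms(3) A.topspace_topol by (intro \<Phi>_open[OF assms(1,2), of "carrier A"]) (auto simp: compact_space_def)

lemma \<Phi>_open_integer:
  assumes U: "U \<in> Ext E H" "openin (topol (tg_sub G H)) U"
    and \<phi>: "ric_iso G (flat G E) D (const_functor discrete_integer_group) \<phi>"
  shows "openin (topol B) (\<Phi> (H, U))"
proof -
  interpret Q: group "Q U" using Q_group[OF U(1)] .
  obtain \<psi> where "ric_morphism G (flat G E) (const_functor discrete_integer_group) D \<psi>"
    and inv: "\<forall>x\<in>Base (flat G E). \<forall>a\<in>carrier (Obj D x). \<psi> x (\<phi> x a) = a"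
    using \<phi> by (auto simp: ric_iso_def)
  then have "\<psi> H \<in> hom discrete_integer_group A"
    using ric_morphism.hom[OF _ H] by (fastforce simp: tg_hom_def const_functor_def)
  then have cl: "\<psi> H i \<in> carrier A" and add: "\<psi> H (i + j) = \<psi> H i \<otimes>\<^bsub>A\<^esub> \<psi> H j" for i j :: int
    by (auto simp: hom_def discrete_integer_group_def)
  show ?thesis
  proof (rule \<Phi>_open[OF U])
    show "compactin (topol A) {\<psi> H 1}"
      using cl by (simp add: A.topspace_topol)
    fix f assume f: "f \<in> tg_Hom_set A (Q U)" and "\<forall>d\<in>{\<psi> H 1}. f d = \<one>\<^bsub>Q U\<^esub>"
    then have f1: "f (\<psi> H 1) = \<one>\<^bsub>Q U\<^esub>" by simp
    have fcl: "f (\<psi> H i) \<in> carrier (Q U)" for i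
      using tg_Hom_setD(1)[OF f cl] .
    \<comment> \<open>As \<open>f\<close> kills the generator, its values along
      \<open>\<psi> H\<close> are constant; the common value is the one at \<open>1\<close>, which
      is the unit.\<close>
    have step: "f (\<psi> H (i + 1)) = f (\<psi> H i)" for i
      using tg_Hom_setD(2)[OF f cl cl, of i 1] Q.r_one[OF fcl] by (simp only: add f1)
    have "f (\<psi> H 1) = f (\<psi> H 0) "
      using step[of 0] by simp
    then have zero: "f (\<psi> H 0) = \<one>\<^bsub>Q U\<^esub>"
      using f1 by simp
    have "f (\<psi> H i) = \<one>\<^bsub>Q U\<^esub>" for i
    proof (induction i rule: int_induct[where k = 0])
      case base
      show ?case by (rule zero)
    next
      case (step1 i)
      then show ?case using step[of i] by simp
    next
      case (step2 i)
      then show ?case using step[of "i - 1"] by simp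
    qed
    moreover have "d = \<psi> H (\<phi> H d)" if "d \<in> carrier A" for d
      using inv H that by simp
    ultimately show "\<forall>d\<in>carrier A. f d = \<one>\<^bsub>Q U\<^esub>"
      by metis
  qed
qed

text \<open>Since \<open>UR (UR U) = UR U\<close>, membership in either group means that the
  homomorphism belonging to \<open>c\<close> at level \<open>U\<close> takes values in
  \<open>UR U\<close>.\<close>

lemma \<Phi>_absorb:
  assumes U: "U \<in> Ext E H" and UR: "UR U \<in> Ext E H" "(H, U) \<in> DInd E (H, UR U)"
  shows "\<Phi> (H, UR U) = \<Phi> (H, U)"
proof
  have sub: "U \<subseteq> UR U"
    using S.subset_set_mult(1)[OF normal_imp_subgroup[OF Ext_normal(1)[OF U]] normal_imp_subgroup[OF ab(3)]]
    by simp
  show "\<Phi> (H, U) \<subseteq> \<Phi> (H, UR U)"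
    using \<Phi>_mono[OF UR U] .
  show "\<Phi> (H, UR U) \<subseteq> \<Phi> (H, U)"
  proof
    fix c assume c: "c \<in> \<Phi> (H, UR U)"
    then have cB: "c \<in> carrier B"
      using subgroup.mem_carrier[OF \<Phi>_subgroup[OF UR(1)]] by blast
    obtain f where f: "f \<in> tg_Hom_set A (Q U)" "\<theta> (H, U) f = \<Phi> (H, U) #>\<^bsub>B\<^esub> c"
      using \<theta>_surj[OF U cB] .
    have "\<forall>d\<in>carrier A. f d \<subseteq> UR U"
      using c mem_\<Phi>_iff[OF UR(1) U sub UR(2) f(1) cB f(2)] UR_UR[OF U] by simp
    then show "c \<in> \<Phi> (H, U)"
      \<comment> \<open>The criterion is applied with \<open>U1 = U2 = U\<close>, where the required
        induction exists by reflexivity.\<close>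
      using mem_\<Phi>_iff[OF U U subset_refl DInd_refl f(1) cB f(2)] U by (simp add: Ext_iff)
  qed
qed

lemma Hom_subquotient:
  assumes U: "U1 \<in> Ext E H" "U2 \<in> Ext E H" "U2 \<subseteq> U1"
  shows "tg_Hom_set A (tg_quot (tg_sub G (UR U1)) (UR U2))
    = {f \<in> tg_Hom_set A (Q U2). \<forall>d\<in>carrier A. f d \<subseteq> UR U1}"
  using S.tg_Hom_set_tg_sub[OF A.topspace_topol UR(2)[OF U(2)] UR(4)[OF U(1)] UR_mono[OF U(3)]]
    tg_sub_tg_sub[of "UR U1" H G] subgroup.subset[OF UR(2)[OF U(1)]] by simp

lemma \<theta>_image:
  assumes U: "U1 \<in> Ext E H" "U2 \<in> Ext E H" "U2 \<subseteq> U1" "(H, U2) \<in> DInd E (H, U1)"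
  shows "\<theta> (H, U2) ` {f \<in> tg_Hom_set A (Q U2). \<forall>d\<in>carrier A. f d \<subseteq> UR U1}
    = (\<lambda>c. \<Phi> (H, U2) #>\<^bsub>B\<^esub> c) ` \<Phi> (H, U1)"
proof (intro equalityI subsetI)
  fix X assume "X \<in> \<theta> (H, U2) ` {f \<in> tg_Hom_set A (Q U2). \<forall>d\<in>carrier A. f d \<subseteq> UR U1}"
  then obtain f where f: "f \<in> tg_Hom_set A (Q U2)" "\<forall>d\<in>carrier A. f d \<subseteq> UR U1" "X = \<theta> (H, U2) f"
    by blast
  obtain c where c: "c \<in> carrier B" "\<theta> (H, U2) f = \<Phi> (H, U2) #>\<^bsub>B\<^esub> c"
    using \<theta>_rep[OF U(2) f(1)] .
  show "X \<in> (\<lambda>c. \<Phi> (H, U2) #>\<^bsub>B\<^esub> c) ` \<Phi> (H, U1)"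
    using mem_\<Phi>_iff[OF U f(1) c] f(2) c(2) unfolding f(3) by blast
next
  fix X assume "X \<in> (\<lambda>c. \<Phi> (H, U2) #>\<^bsub>B\<^esub> c) ` \<Phi> (H, U1)"
  then obtain c where c: "c \<in> \<Phi> (H, U1)" "X = \<Phi> (H, U2) #>\<^bsub>B\<^esub> c"
    by blast
  have cB: "c \<in> carrier B"
    using subgroup.mem_carrier[OF \<Phi>_subgroup[OF U(1)] c(1)] .
  obtain f where f: "f \<in> tg_Hom_set A (Q U2)" "\<theta> (H, U2) f = \<Phi> (H, U2) #>\<^bsub>B\<^esub> c"
    using \<theta>_surj[OF U(2) cB] .
  show "X \<in> \<theta> (H, U2) ` {f \<in> tg_Hom_set A (Q U2). \<forall>d\<in>carrier A. f d \<subseteq> UR U1}"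
    using mem_\<Phi>_iff[OF U f(1) cB f(2)] f c by blast
qed

lemma \<theta>_Hom_subquotient:
  assumes U: "U1 \<in> Ext E H" "U2 \<in> Ext E H" "U2 \<subseteq> U1" "(H, U2) \<in> DInd E (H, U1)"
  shows "\<theta> (H, U2) ` (compose (carrier A) (\<lambda>X. X) ` carrier (tg_Hom A (tg_quot (tg_sub G (UR U1)) (UR U2))))
      = carrier (tg_quot (tg_sub B (\<Phi> (H, U1))) (\<Phi> (H, U2)))"
    and "subgroup (carrier (tg_quot (tg_sub B (\<Phi> (H, U1))) (\<Phi> (H, U2)))) (Z U2)"
proof -
  have carr: "carrier (tg_quot (tg_sub B (\<Phi> (H, U1))) (\<Phi> (H, U2))) = (\<lambda>c. \<Phi> (H, U2) #>\<^bsub>B\<^esub> c) ` \<Phi> (H, U1)"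
    by (simp add: rcosets_eq_image)
  \<comment> \<open>The inclusion of the subquotient is the identity on cosets, and composing with
    it does not change an extensional function.\<close>
  have "compose (carrier A) (\<lambda>X. X) f = f" if "f \<in> tg_Hom_set A (Q U2)" for f
    using tg_Hom_setD(4)[OF that] by (auto simp: compose_def extensional_restrict fun_eq_iff extensional_def)
  then have "compose (carrier A) (\<lambda>X. X) ` carrier (tg_Hom A (tg_quot (tg_sub G (UR U1)) (UR U2)))
      = {f \<in> tg_Hom_set A (Q U2). \<forall>d\<in>carrier A. f d \<subseteq> UR U1}"
    unfolding tg_Hom_sel Hom_subquotient[OF U(1-3)] by force
  then show "\<theta> (H, U2) ` (compose (carrier A) (\<lambda>X. X) ` carrier (tg_Hom A (tg_quot (tg_sub G (UR U1)) (UR U2))))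
      = carrier (tg_quot (tg_sub B (\<Phi> (H, U1))) (\<Phi> (H, U2)))"
    unfolding carr using \<theta>_image[OF U] by simp
  show "subgroup (carrier (tg_quot (tg_sub B (\<Phi> (H, U1))) (\<Phi> (H, U2)))) (Z U2)"
    unfolding carr using B.subgroup_tg_quot[OF \<Phi>_normal[OF U(2)] \<Phi>_subgroup[OF U(1)]] .
qed

text \<open>At level \<open>U1 \<inter> U2\<close>, a homomorphism has values in both groups iff it
  has values in their intersection. The intersection still contains \<open>R H\<close>, so
  L-coherence supplies both induction maps.\<close>

lemma \<Phi>_Int:
  assumes U: "U1 \<in> Ext_R E R H" "U2 \<in> Ext_R E R H" "U1 \<inter> U2 \<in> Ext E H"
  shows "\<Phi> (H, U1 \<inter> U2) = \<Phi> (H, U1) \<inter> \<Phi> (H, U2)"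
proof -
  have U0: "U1 \<inter> U2 \<in> Ext_R E R H"
    using U by (auto simp: Ext_R_def)
  note E = Ext_R_D(1)[OF U(1)] Ext_R_D(1)[OF U(2)] U(3)
  note D = Ext_R_DInd[OF U(1) U0 Int_lower1] Ext_R_DInd[OF U(2) U0 Int_lower2]
  note R = Ext_R_D(3)[OF U(1)] Ext_R_D(3)[OF U(2)] Ext_R_D(3)[OF U0]
  have "c \<in> \<Phi> (H, U1 \<inter> U2)" if c: "c \<in> \<Phi> (H, U1)" "c \<in> \<Phi> (H, U2)" for c
  proof -
    have cB: "c \<in> carrier B"
      using subgroup.mem_carrier[OF \<Phi>_subgroup[OF E(1)] c(1)] .
    obtain f where f: "f \<in> tg_Hom_set A (Q (U1 \<inter> U2))" "\<theta> (H, U1 \<inter> U2) f = \<Phi> (H, U1 \<inter> U2) #>\<^bsub>B\<^esub> c"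
      using \<theta>_surj[OF E(3) cB] .
    show ?thesis
      using c mem_\<Phi>_iff[OF E(1,3) Int_lower1 D(1) f(1) cB f(2)] mem_\<Phi>_iff[OF E(2,3) Int_lower2 D(2) f(1) cB f(2)]
        mem_\<Phi>_iff[OF E(3,3) subset_refl DInd_refl f(1) cB f(2)] E(3)
      by (simp add: R Ext_iff)
  qed
  then show ?thesis
    using \<Phi>_mono[OF E(1) D(1) E(3)] \<Phi>_mono[OF E(2) D(2) E(3)] by blast
qed

lemma \<Phi>_set_mult:
  assumes U: "U1 \<in> Ext_R E R H" "U2 \<in> Ext_R E R H" "U1 \<inter> U2 \<in> Ext E H" "U1 <#>\<^bsub>G\<^esub> U2 \<in> Ext E H"
  shows "\<Phi> (H, U1 <#>\<^bsub>G\<^esub> U2) = \<Phi> (H, U1) <#>\<^bsub>B\<^esub> \<Phi> (H, U2)"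
proof
  note E = Ext_R_D(1)[OF U(1)] Ext_R_D(1)[OF U(2)]
  have sub: "U1 \<subseteq> U1 <#>\<^bsub>G\<^esub> U2" "U2 \<subseteq> U1 <#>\<^bsub>G\<^esub> U2"
    using S.subset_set_mult[OF normal_imp_subgroup[OF Ext_normal(1)[OF E(1)]] normal_imp_subgroup[OF Ext_normal(1)[OF E(2)]]]
    by simp_all
  have U0: "U1 \<inter> U2 \<in> Ext_R E R H" and U12: "U1 <#>\<^bsub>G\<^esub> U2 \<in> Ext_R E R H"
    using U sub by (auto simp: Ext_R_def)
  note R = Ext_R_D(3)[OF U(1)] Ext_R_D(3)[OF U(2)] Ext_R_D(3)[OF U0] Ext_R_D(3)[OF U12]
  have sub0: "U1 \<inter> U2 \<subseteq> U1 <#>\<^bsub>G\<^esub> U2"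
    using sub by blast
  show "\<Phi> (H, U1) <#>\<^bsub>B\<^esub> \<Phi> (H, U2) \<subseteq> \<Phi> (H, U1 <#>\<^bsub>G\<^esub> U2)"
    using \<Phi>_mono[OF U(4) Ext_R_DInd[OF U12 U(1) sub(1)] E(1)] \<Phi>_mono[OF U(4) Ext_R_DInd[OF U12 U(2) sub(2)] E(2)]
    by (rule B.set_mult_subset_subgroup[OF \<Phi>_subgroup[OF U(4)]])
  show "\<Phi> (H, U1 <#>\<^bsub>G\<^esub> U2) \<subseteq> \<Phi> (H, U1) <#>\<^bsub>B\<^esub> \<Phi> (H, U2)"
  proof
    fix c assume c: "c \<in> \<Phi> (H, U1 <#>\<^bsub>G\<^esub> U2)"
    have cB: "c \<in> carrier B"
      using subgroup.mem_carrier[OF \<Phi>_subgroup[OF U(4)] c] .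
    obtain f where f: "f \<in> tg_Hom_set A (Q (U1 \<inter> U2))" "\<theta> (H, U1 \<inter> U2) f = \<Phi> (H, U1 \<inter> U2) #>\<^bsub>B\<^esub> c"
      using \<theta>_surj[OF U(3) cB] .
    have fsub: "f d \<subseteq> U1 <#>\<^bsub>tg_sub G H\<^esub> U2" if "d \<in> carrier A" for d
      using mem_\<Phi>_iff[OF U(4,3) sub0 Ext_R_DInd[OF U12 U0 sub0] f(1) cB f(2)] c that by (simp add: R)
    \<comment> \<open>The two components of \<open>f\<close> give, through \<open>\<theta>\<close>,
      the two factors of \<open>c\<close>.\<close>
    obtain f1 f2 where f12: "f1 \<in> tg_Hom_set A (Q (U1 \<inter> U2))" "f2 \<in> tg_Hom_set A (Q (U1 \<inter> U2))"
      and fs: "\<And>d. d \<in> carrier A \<Longrightarrow> f1 d \<subseteq> U1" "\<And>d. d \<in> carrier A \<Longrightarrow> f2 d \<subseteq> U2"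
      and prod: "f = f1 \<otimes>\<^bsub>W (U1 \<inter> U2)\<^esub> f2"
      using S.tg_Hom_split[OF Ext_normal[OF E(1)] Ext_normal[OF E(2)] A.topspace_topol A.is_group
          f(1)[unfolded R(3)] fsub] unfolding R(3) by blast
    obtain c1 where c1: "c1 \<in> carrier B" "\<theta> (H, U1 \<inter> U2) f1 = \<Phi> (H, U1 \<inter> U2) #>\<^bsub>B\<^esub> c1"
      using \<theta>_rep[OF U(3) f12(1)] .
    obtain c2 where c2: "c2 \<in> carrier B" "\<theta> (H, U1 \<inter> U2) f2 = \<Phi> (H, U1 \<inter> U2) #>\<^bsub>B\<^esub> c2"
      using \<theta>_rep[OF U(3) f12(2)] .
    have m1: "c1 \<in> \<Phi> (H, U1)"
      using mem_\<Phi>_iff[OF E(1) U(3) Int_lower1 Ext_R_DInd[OF U(1) U0 Int_lower1] f12(1) c1] fs(1) by (simp add: R)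
    have m2: "c2 \<in> \<Phi> (H, U2)"
      using mem_\<Phi>_iff[OF E(2) U(3) Int_lower2 Ext_R_DInd[OF U(2) U0 Int_lower2] f12(2) c2] fs(2) by (simp add: R)
    have "\<Phi> (H, U1 \<inter> U2) #>\<^bsub>B\<^esub> c = \<Phi> (H, U1 \<inter> U2) #>\<^bsub>B\<^esub> (c1 \<otimes>\<^bsub>B\<^esub> c2)"
      using \<theta>_mult[OF U(3) f12] normal.rcos_sum[OF \<Phi>_normal[OF U(3)] c1(1) c2(1)]
      unfolding prod[symmetric] f(2) c1(2) c2(2) by simp
    then have "c \<in> \<Phi> (H, U1 \<inter> U2) #>\<^bsub>B\<^esub> (c1 \<otimes>\<^bsub>B\<^esub> c2)"
      using B.rcos_self[OF cB \<Phi>_subgroup[OF U(3)]] by simp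
    then obtain p where p: "p \<in> \<Phi> (H, U1 \<inter> U2)" "c = p \<otimes>\<^bsub>B\<^esub> (c1 \<otimes>\<^bsub>B\<^esub> c2)"
      by (auto simp: r_coset_def)
    \<comment> \<open>The product \<open>c1 \<otimes> c2\<close> agrees with \<open>c\<close> only
      up to a factor \<open>p\<close> in \<open>\<Phi> (H, U1 \<inter> U2)\<close>, which is
      absorbed into the first factor.\<close>
    have p1: "p \<in> \<Phi> (H, U1)"
      using p(1) \<Phi>_Int[OF U(1-3)] by blast
    have "c = (p \<otimes>\<^bsub>B\<^esub> c1) \<otimes>\<^bsub>B\<^esub> c2"
      using p(2) c1(1) c2(1) subgroup.mem_carrier[OF \<Phi>_subgroup[OF E(1)] p1] by (simp add: B.m_assoc)
    then show "c \<in> \<Phi> (H, U1) <#>\<^bsub>B\<^esub> \<Phi> (H, U2)"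
      using subgroup.m_closed[OF \<Phi>_subgroup[OF E(1)] p1 m1] m2 by (auto simp: set_mult_def)
  qed
qed

text \<open>Homomorphisms into \<open>U1 / U2\<close> correspond to elements of
  \<open>\<Phi> (H, U1) / \<Phi> (H, U2)\<close>. If the latter is trivial, so is the former, and
  the second condition of L-coherence applies.\<close>

lemma \<Phi>_eq_imp_eq:
  assumes U: "U1 \<in> Ext_R E R H" "U2 \<in> Ext_R E R H" "U2 \<subseteq> U1" and eq: "\<Phi> (H, U1) = \<Phi> (H, U2)"
  shows "U1 = U2"
proof -
  note E = Ext_R_D(1)[OF U(1)] Ext_R_D(1)[OF U(2)]
  note R = Ext_R_D(3)[OF U(1)] Ext_R_D(3)[OF U(2)]
  let ?Q = "tg_quot (tg_sub G U1) U2"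
  have Hom: "tg_Hom_set A ?Q = {f \<in> tg_Hom_set A (Q U2). \<forall>d\<in>carrier A. f d \<subseteq> U1}"
    using Hom_subquotient[OF E U(3)] by (simp only: R)
  have one: "\<one>\<^bsub>tg_Hom A ?Q\<^esub> = \<one>\<^bsub>W U2\<^esub>"
    by (simp add: tg_Hom_one R)
  have "f = \<one>\<^bsub>W U2\<^esub>" if f: "f \<in> tg_Hom_set A (Q U2)" "\<forall>d\<in>carrier A. f d \<subseteq> U1" for f
  proof -
    obtain c where c: "c \<in> carrier B" "\<theta> (H, U2) f = \<Phi> (H, U2) #>\<^bsub>B\<^esub> c"
      using \<theta>_rep[OF E(2) f(1)] .
    have "c \<in> \<Phi> (H, U2)"
      using mem_\<Phi>_iff[OF E U(3) Ext_R_DInd[OF U] f(1) c] f(2) unfolding R eq by blast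
    then have "\<theta> (H, U2) f = \<theta> (H, U2) \<one>\<^bsub>W U2\<^esub>"
      using B.rcos_eq_self_iff[OF \<Phi>_subgroup[OF E(2)] c(1)] c(2) \<theta>_one[OF E(2)] by simp
    then show ?thesis
      by (rule \<theta>_inj[OF E(2) f(1) one_closed[OF E(2)]])
  qed
  \<comment> \<open>The trivial homomorphism has the constant value
    \<open>U2 \<subseteq> U1\<close>, so it does belong to the set that is shown to be a
    singleton.\<close>
  moreover have "\<one>\<^bsub>W U2\<^esub> d \<subseteq> U1" if "d \<in> carrier A" for d
    using that U(3) by (simp add: tg_Hom_one R)
  ultimately have "carrier (tg_Hom A ?Q) = {\<one>\<^bsub>tg_Hom A ?Q\<^esub>}"
    unfolding tg_Hom_sel Hom one using one_closed[OF E(2)] by blast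
  then show ?thesis
    using coherent H U unfolding L_coherent_def by blast
qed

text \<open>Two members of the lattice need not be comparable, so each is compared with their
  intersection, which has the same image by \<open>\<Phi>_Int\<close>.\<close>

lemma \<Phi>_inj_on:
  assumes L: "R_lattice G E R L"
  shows "inj_on (\<lambda>V. \<Phi> (H, V)) (L H)"
proof (rule inj_onI)
  fix U1 U2 assume U: "U1 \<in> L H" "U2 \<in> L H" and eq: "\<Phi> (H, U1) = \<Phi> (H, U2)"
  have UR: "U1 \<in> Ext_R E R H" "U2 \<in> Ext_R E R H" "U1 \<inter> U2 \<in> Ext_R E R H"
    using L H U by (auto simp: R_lattice_def)
  have "\<Phi> (H, U1 \<inter> U2) = \<Phi> (H, U1)"
    using \<Phi>_Int[OF UR(1,2) Ext_R_D(1)[OF UR(3)]] eq by simp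
  then have "U1 = U1 \<inter> U2" "U2 = U1 \<inter> U2"
    using \<Phi>_eq_imp_eq[OF UR(1,3)] \<Phi>_eq_imp_eq[OF UR(2,3)] eq by auto
  then show "U1 = U2" by simp
qed

end

theorem theorem3p4p14:
  fixes G :: "'g tgroup"
    and E :: "('g, 'g set \<times> 'g set) ric_domain"
    and R :: "'g set \<Rightarrow> 'g set"
    and D :: "('g, 'g set, 'd) ric_functor"
    and C :: "('g, 'g set, 'c) ric_functor"
    and \<Phi> :: "'g set \<times> 'g set \<Rightarrow> 'c set"
    and \<theta> :: "'g set \<times> 'g set \<Rightarrow> ('d \<Rightarrow> 'g set) \<Rightarrow> 'c set"
    and H U :: "'g set"
  assumes "topological_group G" and "compact_space (topol G)" and "Hausdorff_space (topol G)"
    and "classification_datum G E R D" and "L_coherent G E R D"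
    and "spectrum_representation G E C \<Phi>"
    and "ric_iso G E (ric_Hom E (lift_functor D) (Pi_functor G R))
           (ric_quotient E (lift_functor C) \<Phi>) \<theta>"
    and "(H, U) \<in> Base E"
  shows
    \<comment> \<open>(i)\<close>
    "closedin (topol (Obj C H)) (\<Phi> (H, U)) \<and>
    \<comment> \<open>(ii)\<close>
    (openin (subtopology (topol G) H) U \<and>
        ((\<exists>\<phi>. ric_iso G (flat G E) D (const_functor discrete_integer_group) \<phi>) \<or>
         (\<forall>K\<in>Base (flat G E). compact_space (topol (Obj D K))))
      \<longrightarrow> openin (topol (Obj C H)) (\<Phi> (H, U))) \<and>
    \<comment> \<open>(iii). L-coherence provides \<open>ind\<close> between \<open>(H, U2)\<close> and \<open>(H, U1)\<close> only for \<open>U1, U2 \<in> Ext_R E R H\<close>;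
      for other members of \<open>Ext E H\<close> parts (iii), (v), (vi) fail unless it is assumed to exist.\<close>
    (U <#>\<^bsub>G\<^esub> R H \<in> Ext E H \<and> (H, U) \<in> DInd E (H, U <#>\<^bsub>G\<^esub> R H)
      \<longrightarrow> \<Phi> (H, U <#>\<^bsub>G\<^esub> R H) = \<Phi> (H, U)) \<and>
    \<comment> \<open>(iv)\<close>
    (\<forall>g\<in>carrier G. Con C g H ` \<Phi> (H, U) = \<Phi> (conj_set G g H, conj_set G g U)) \<and>
    \<comment> \<open>(v)\<close>
    ((\<lambda>V. \<Phi> (H, V)) \<in> Ext E H \<rightarrow> {X. closed_subgroup X (Obj C H)} \<and>
     (\<forall>U1\<in>Ext E H. \<forall>U2\<in>Ext E H. U2 \<subseteq> U1 \<and> (H, U2) \<in> DInd E (H, U1)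
        \<longrightarrow> \<Phi> (H, U2) \<subseteq> \<Phi> (H, U1))) \<and>
    \<comment> \<open>(vi)\<close>
    (\<forall>U1\<in>Ext E H. \<forall>U2\<in>Ext E H. U2 \<subseteq> U1 \<and> (H, U2) \<in> DInd E (H, U1) \<longrightarrow>
        \<theta> (H, U2) ` (compose (carrier (Obj D H)) (\<lambda>X. X) `
            carrier (tg_Hom (Obj D H) (tg_quot (tg_sub G (U1 <#>\<^bsub>G\<^esub> R H)) (U2 <#>\<^bsub>G\<^esub> R H))))
          = carrier (tg_quot (tg_sub (Obj C H) (\<Phi> (H, U1))) (\<Phi> (H, U2))) \<and>
        subgroup (carrier (tg_quot (tg_sub (Obj C H) (\<Phi> (H, U1))) (\<Phi> (H, U2))))
          (tg_quot (Obj C H) (\<Phi> (H, U2)))) \<and>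
    \<comment> \<open>(vii)\<close>
    (\<forall>U1\<in>Ext_R E R H. \<forall>U2\<in>Ext_R E R H. U1 <#>\<^bsub>G\<^esub> U2 \<in> Ext E H \<and> U1 \<inter> U2 \<in> Ext E H
      \<longrightarrow> \<Phi> (H, U1 <#>\<^bsub>G\<^esub> U2) = \<Phi> (H, U1) <#>\<^bsub>Obj C H\<^esub> \<Phi> (H, U2)) \<and>
    \<comment> \<open>(viii)\<close>
    (\<forall>U1\<in>Ext_R E R H. \<forall>U2\<in>Ext_R E R H. U1 \<inter> U2 \<in> Ext E H
      \<longrightarrow> \<Phi> (H, U1 \<inter> U2) = \<Phi> (H, U1) \<inter> \<Phi> (H, U2)) \<and>
    \<comment> \<open>(ix)\<close>
    (\<forall>L. R_lattice G E R L \<longrightarrow>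
      (\<lambda>V. \<Phi> (H, V)) \<in> L H \<rightarrow> {X. closed_subgroup X (Obj C H)} \<and>
      inj_on (\<lambda>V. \<Phi> (H, V)) (L H))"
proof -
  interpret coherent_representation_at G E R D C \<Phi> \<theta> H
    using assms
    by (auto simp: coherent_representation_at_def coherent_representation_def
        coherent_representation_at_axioms_def compact_group_def compact_group_axioms_def Base_flat
        intro: rev_image_eqI)
  have U: "U \<in> Ext E H"
    using assms(8) by (simp add: Ext_iff)
  have closed: "(\<lambda>V. \<Phi> (H, V)) \<in> Ext E H \<rightarrow> {X. closed_subgroup X (Obj C H)}"
    using \<Phi>_subgroup \<Phi>_closed by (simp add: closed_subgroup_def)
  have L: "L H \<subseteq> Ext E H" if "R_lattice G E R L" for L
    using that H by (auto simp: R_lattice_def Ext_R_def)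
  have open_U: "openin (topol (Obj C H)) (\<Phi> (H, U))"
    if o: "openin (subtopology (topol G) H) U"
      and or: "(\<exists>\<phi>. ric_iso G (flat G E) D (const_functor discrete_integer_group) \<phi>) \<or>
         (\<forall>K\<in>Base (flat G E). compact_space (topol (Obj D K)))"
  proof -
    from o have o: "openin (topol (tg_sub G H)) U" by simp
    from or consider \<phi> where "ric_iso G (flat G E) D (const_functor discrete_integer_group) \<phi>"
      | "compact_space (topol (Obj D H))"
      using H by blast
    then show ?thesis
      using \<Phi>_open_integer[OF U o] \<Phi>_open_compact[OF U o] by cases
  qed
  show ?thesis
    \<comment> \<open>The goals follow the order of the assertions; (v), (vi) and (ix) contribute
      two each.\<close>
    apply (intro conjI impI ballI allI; (elim conjE)?)
    subgoal by (rule \<Phi>_closed[OF U])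
    subgoal by (rule open_U)
    subgoal by (rule \<Phi>_absorb[OF U])
    subgoal by (rule \<Phi>_con_image[OF assms(8)])
    subgoal by (rule closed)
    subgoal by (rule \<Phi>_mono)
    subgoal by (rule \<theta>_Hom_subquotient(1))
    subgoal by (rule \<theta>_Hom_subquotient(2))
    subgoal by (rule \<Phi>_set_mult)
    subgoal by (rule \<Phi>_Int)
    subgoal for L using closed L[of L] by blast
    subgoal by (rule \<Phi>_inj_on)
    done
qed

end
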